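(* Let $\Lambda\subset(0,\infty)$ be a finitely generated multiplicative subgroup, isomorphic to $\mathbb{Z}^N$, and let $\Gamma\subset\mathbb{R}$ be a countable $\mathbb{Z}\Lambda$-module which is dense in $\mathbb{R}$. Let $\mathcal{S}:=\mathbb{R}_\Gamma\rtimes(\Gamma\rtimes\Lambda)$ be the Stein groupoid and let $\pi:\mathcal{S}\to\Gamma\rtimes\Lambda$ be the natural homomorphism. Suppose $\operatorname{rank}\Gamma\geq2$. Then the action $\Gamma\rtimes\Lambda\curvearrowright\mathbb{R}_\Gamma$ is $H^1$-rigid, that is, $\pi$ induces an isomorphism between $H^1(\mathcal{S})$ and $H^1(\Gamma\rtimes\Lambda)=\operatorname{Hom}(\Gamma\rtimes\Lambda,\mathbb{Z})$.
   Context: "$\Gamma\subset\mathbb{R}$ is a $\mathbb{Z}\Lambda$-module" means that $\Gamma$ is an additive subgroup of $\mathbb{R}$ with $\lambda\Gamma\subset\Gamma$ for all $\lambda\in\Lambda$. $\operatorname{rank}\Gamma:=\dim_{\mathbb{Q}}(\Gamma\otimes\mathbb{Q})$ (possibly infinite). The space $\mathbb{R}_\Gamma$: as a set $\mathbb{R}_\Gamma=(\mathbb{R}\setminus\Gamma)\sqcup\{t_+,t_-\mid t\in\Gamma\}$, with the canonical surjection $q:\mathbb{R}_\Gamma\to\mathbb{R}$ ($q(t_\pm)=t$, $q(x)=x$ for $x\notin\Gamma$), the total order such that $q(x)<q(y)$ implies $x<y$ and $t_-<t_+$ for $t\in\Gamma$, and the order topology. It is totally disconnected and locally compact Hausdorff;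 the sets $[t_+,s_-]$ ($t<s$ in $\Gamma$) are compact open and form a basis. The group $\Gamma\rtimes\Lambda$ (with $(s,\lambda)(s',\lambda')=(s+\lambda s',\lambda\lambda')$) acts on $\mathbb{R}_\Gamma$ by $(s,\lambda)\cdot x=\lambda x+s$ for $x\in\mathbb{R}\setminus\Gamma$ and $(s,\lambda)\cdot t_\pm=(\lambda t+s)_\pm$. For an action of a discrete group $G$ on $X$, the transformation groupoid $X\rtimes G$ is $X\times G$ with the product topology, unit space $X$ (identified with $X\times\{1\}$), $r(x,\gamma)=x$, $s(x,\gamma)=\gamma^{-1}x$, $(x,\gamma)(\gamma^{-1}x,\gamma')=(x,\gamma\gamma')$; the natural homomorphism $\pi:X\rtimes G\to G$ is $\pi(x,\gamma)=\gamma$. For an ample groupoid $\mathcal{G}$, $H^1(\mathcal{G})=H^1(\mathcal{G},\mathbb{Z})$ is the group of continuous homomorphisms $\xi:\mathcal{G}\to\mathbb{Z}$ modulo coboundaries, i.e. homomorphisms of the form $g\mapsto f(r(g))-f(s(g))$ with $f:\mathcal{G}^{(0)}\to\mathbb{Z}$ continuous. A homomorphism $\pi$ induces $H^1(\pi):[\xi]\mapsto[\xi\circ\pi]$. An action $G\curvearrowright X$ is $H^1$-rigid if $H^1(\pi):\operatorname{Hom}(G,\mathbb{Z})=H^1(G)\to H^1(X\rtimes G)$ is an isomorphism, where $\pi:X\rtimes G\to G$ is the natural homomorphism. *)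

theory Defs
  imports "HOL-Analysis.Analysis" "HOL-Algebra.Product_Groups" "HOL-Algebra.Generated_Groups" "HOL-Library.Extended_Nat"
begin

section \<open>Subgroups of the reals and their rank\<close>

definition real_add_group :: "real monoid"
  where "real_add_group = \<lparr>carrier = UNIV, monoid.mult = (+), one = 0\<rparr>"

definition pos_real_mult_group :: "real monoid"
  where "pos_real_mult_group = \<lparr>carrier = {0<..}, monoid.mult = (*), one = 1\<rparr>"

definition ZL_module :: "real set \<Rightarrow> real set \<Rightarrow> bool"
  where "ZL_module \<Lambda> \<Gamma> \<longleftrightarrow>
    subgroup \<Gamma> real_add_group \<and> (\<forall>l\<in>\<Lambda>. (\<lambda>t. l * t) ` \<Gamma> \<subseteq> \<Gamma>)"

interpretation rat_real: vector_space "\<lambda>(q::rat) (x::real). of_rat q * x"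
  by unfold_locales (simp_all add: algebra_simps of_rat_add of_rat_mult)

text \<open>
  For a subgroup \<open>\<Gamma>\<close> of the reals, the tensor product of \<open>\<Gamma>\<close> with the rationals is realised as
  the rational span of \<open>\<Gamma>\<close> in the reals, with \<open>\<gamma> \<otimes> q\<close> corresponding to \<open>q * \<gamma>\<close>; its universal
  property is \<open>rat_span_is_tensor_product\<close> below. The case distinction is needed because the
  library's \<open>dim\<close> is \<open>0\<close> on infinite-dimensional spaces.
\<close>

definition ab_rank :: "real set \<Rightarrow> enat"
  where "ab_rank \<Gamma> =
    (if \<exists>B. finite B \<and> rat_real.span B = rat_real.span \<Gamma>
     then enat (rat_real.dim (rat_real.span \<Gamma>)) else \<infinity>)"

lemma real_subgroupD:
  assumes "subgroup \<Gamma> real_add_group"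
  shows "0 \<in> \<Gamma>" "\<And>x y. x \<in> \<Gamma> \<Longrightarrow> y \<in> \<Gamma> \<Longrightarrow> x + y \<in> \<Gamma>" "\<And>x. x \<in> \<Gamma> \<Longrightarrow> - x \<in> \<Gamma>"
proof -
  interpret R: group real_add_group
  proof (rule groupI)
    show "\<exists>y\<in>carrier real_add_group. y \<otimes>\<^bsub>real_add_group\<^esub> x = \<one>\<^bsub>real_add_group\<^esub>" for x
      by (rule bexI[of _ "- x"]) (simp_all add: real_add_group_def)
  qed (simp_all add: real_add_group_def)
  have inv: "inv\<^bsub>real_add_group\<^esub> x = - x" for x
    by (rule R.inv_equality) (auto simp: real_add_group_def)
  show "0 \<in> \<Gamma>" "\<And>x y. x \<in> \<Gamma> \<Longrightarrow> y \<in> \<Gamma> \<Longrightarrow> x + y \<in> \<Gamma>"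
    using subgroup.one_closed[OF assms] subgroup.m_closed[OF assms]
    by (auto simp: real_add_group_def)
  show "\<And>x. x \<in> \<Gamma> \<Longrightarrow> - x \<in> \<Gamma>"
    using subgroup.m_inv_closed[OF assms] inv by simp
qed

lemma real_subgroup_of_int_mult:
  assumes "subgroup \<Gamma> real_add_group" "x \<in> \<Gamma>"
  shows "of_int k * x \<in> \<Gamma>"
proof (induction k rule: int_induct[where k = 0])
  case base
  then show ?case using real_subgroupD[OF assms(1)] by simp
next
  case (step1 i)
  then show ?case using real_subgroupD(2)[OF assms(1), of "of_int i * x" x] assms(2)
    by (simp add: algebra_simps)
next
  case (step2 i)
  then show ?case
    using real_subgroupD(2)[OF assms(1), of "of_int i * x" "- x"] real_subgroupD(3)[OF assms]
    by (simp add: algebra_simps)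
qed

lemma rat_span_real_subgroup:
  assumes \<Gamma>: "subgroup \<Gamma> real_add_group"
  shows "rat_real.span \<Gamma> = {x. \<exists>n::nat. n > 0 \<and> of_nat n * x \<in> \<Gamma>}" (is "_ = ?S")
proof
  have "rat_real.subspace ?S"
    unfolding rat_real.subspace_def
  proof (intro conjI ballI allI)
    show "0 \<in> ?S" using real_subgroupD(1)[OF \<Gamma>] by (simp add: exI[of _ "1::nat"])
  next
    fix x y assume "x \<in> ?S" "y \<in> ?S"
    then obtain m n where mn: "m > 0" "n > 0" "of_nat m * x \<in> \<Gamma>" "of_nat n * y \<in> \<Gamma>" by auto
    have "of_int (int n) * (of_nat m * x) + of_int (int m) * (of_nat n * y) \<in> \<Gamma>"
      by (intro real_subgroupD[OF \<Gamma>] real_subgroup_of_int_mult[OF \<Gamma>] mn)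
    also have "of_int (int n) * (of_nat m * x) + of_int (int m) * (of_nat n * y)
      = of_nat (m * n) * (x + y)" by (simp add: algebra_simps)
    finally have "m * n > 0 \<and> of_nat (m * n) * (x + y) \<in> \<Gamma>" using mn by simp
    then show "x + y \<in> ?S" by blast
  next
    fix q x assume "x \<in> ?S"
    then obtain m where m: "m > 0" "of_nat m * x \<in> \<Gamma>" by auto
    obtain a b where ab: "q = Rat.Fract a b" "b > 0" by (cases q) auto
    have "of_int a * (of_nat m * x) \<in> \<Gamma>" by (intro real_subgroup_of_int_mult[OF \<Gamma>] m)
    also have "of_int a * (of_nat m * x) = of_nat (nat b * m) * (of_rat q * x)"
      using ab by (simp add: of_rat_rat)
    finally have "nat b * m > 0 \<and> of_nat (nat b * m) * (of_rat q * x) \<in> \<Gamma>" using m ab by simp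
    then show "of_rat q * x \<in> ?S" by blast
  qed
  moreover have "\<Gamma> \<subseteq> ?S"
  proof
    fix x assume "x \<in> \<Gamma>"
    then have "(1::nat) > 0 \<and> of_nat 1 * x \<in> \<Gamma>" by simp
    then show "x \<in> ?S" by blast
  qed
  ultimately show "rat_real.span \<Gamma> \<subseteq> ?S" by (rule rat_real.span_minimal[rotated])
next
  show "?S \<subseteq> rat_real.span \<Gamma>"
  proof safe
    fix x :: real and n :: nat assume n: "n > 0" "of_nat n * x \<in> \<Gamma>"
    have "of_rat (1 / of_nat n) * (of_nat n * x) \<in> rat_real.span \<Gamma>"
      by (intro rat_real.span_scale rat_real.span_base n)
    then show "x \<in> rat_real.span \<Gamma>" using n by (simp add: of_rat_divide)
  qed
qed

lemma rat_span_is_tensor_product: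
  fixes f :: "real \<Rightarrow> rat \<Rightarrow> 'b::ab_group_add"
  assumes \<Gamma>: "subgroup \<Gamma> real_add_group"
    and addl: "\<And>x y q. x \<in> \<Gamma> \<Longrightarrow> y \<in> \<Gamma> \<Longrightarrow> f (x + y) q = f x q + f y q"
    and addr: "\<And>x p q. x \<in> \<Gamma> \<Longrightarrow> f x (p + q) = f x p + f x q"
  shows "\<exists>!h. h \<in> extensional (rat_real.span \<Gamma>)
    \<and> (\<forall>x\<in>rat_real.span \<Gamma>. \<forall>y\<in>rat_real.span \<Gamma>. h (x + y) = h x + h y)
    \<and> (\<forall>x\<in>\<Gamma>. \<forall>q. h (of_rat q * x) = f x q)"
proof -
  note sp = rat_span_real_subgroup[OF \<Gamma>]
  note G = real_subgroupD[OF \<Gamma>]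
  have z: "f 0 q = 0" for q using addl[of 0 0 q] G(1) by simp
  have z': "f x 0 = 0" if "x \<in> \<Gamma>" for x using addr[of x 0 0] that by simp
  have natG: "of_nat n * x \<in> \<Gamma>" if "x \<in> \<Gamma>" for n x
    using real_subgroup_of_int_mult[OF \<Gamma> that, of "int n"] by simp
  have bal: "f (of_nat n * x) q = f x (of_nat n * q)" if "x \<in> \<Gamma>" for n x q
  proof (induction n)
    case 0 then show ?case using z z' that by simp
  next
    case (Suc n)
    have "f (of_nat (Suc n) * x) q = f (x + of_nat n * x) q" by (simp add: algebra_simps)
    also have "\<dots> = f x q + f x (of_nat n * q)" using addl[OF that natG[OF that]] Suc by simp
    also have "\<dots> = f x (q + of_nat n * q)" using addr that by simp
    finally show ?case by (simp add: algebra_simps)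
  qed
  define N where "N x = (SOME n::nat. n > 0 \<and> of_nat n * x \<in> \<Gamma>)" for x :: real
  have N: "N x > 0" "of_nat (N x) * x \<in> \<Gamma>" if "x \<in> rat_real.span \<Gamma>" for x
    using someI_ex[of "\<lambda>n::nat. n > 0 \<and> of_nat n * x \<in> \<Gamma>"] that sp unfolding N_def by auto
  define h where "h = restrict (\<lambda>x. f (of_nat (N x) * x) (1 / of_nat (N x))) (rat_real.span \<Gamma>)"
  have h: "h x = f (of_nat n * x) (1 / of_nat n)" if "n > 0" "of_nat n * x \<in> \<Gamma>" for x and n :: nat
  proof -
    have xs: "x \<in> rat_real.span \<Gamma>" using that sp by auto
    have "f (of_nat n * x) (1 / of_nat n) = f (of_nat (N x) * (of_nat n * x)) (1 / (of_nat n * of_nat (N x)))"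
      using bal[OF that(2), of "N x"] N[OF xs] by simp
    also have "\<dots> = f (of_nat n * (of_nat (N x) * x)) (1 / (of_nat n * of_nat (N x)))"
      by (simp add: algebra_simps)
    also have "\<dots> = f (of_nat (N x) * x) (1 / of_nat (N x))"
      using bal[OF N(2)[OF xs], of n] that by simp
    finally show ?thesis using xs by (simp add: h_def)
  qed
  have hq: "h (of_rat q * x) = f x q" if "x \<in> \<Gamma>" for x q
  proof -
    obtain a b where ab: "q = Rat.Fract a b" "b > 0" by (cases q) auto
    define n where "n = nat b"
    have n: "n > 0" "b = int n" using ab by (auto simp: n_def)
    have eq: "of_nat n * (of_rat q * x) = of_int a * x"
      using ab n by (simp add: of_rat_rat)
    have q: "q = of_int a / of_nat n" using ab n by (simp add: Fract_of_int_quotient)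
    have balint: "f (of_int k * x) p = f x (of_int k * p)" for k p
    proof (cases k rule: int_cases2)
      case (nonneg m) then show ?thesis using bal[OF that] by simp
    next
      case (nonpos m)
      have "f (of_nat m * x) p + f (- (of_nat m * x)) p = 0"
        using addl[OF natG[OF that] G(3)[OF natG[OF that]], of m m p] z by simp
      moreover have "f x (of_nat m * p) + f x (- (of_nat m * p)) = 0"
        using addr[OF that, of "of_nat m * p" "- (of_nat m * p)"] z'[OF that] by simp
      ultimately have "f (- (of_nat m * x)) p = f x (- (of_nat m * p))"
        using bal[OF that, of m p] by (metis add_left_cancel)
      then show ?thesis using nonpos by simp
    qed
    have "h (of_rat q * x) = f (of_int a * x) (1 / of_nat n)"
      using h[OF n(1), of "of_rat q * x"] eq real_subgroup_of_int_mult[OF \<Gamma> that] by simp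
    also have "\<dots> = f x q" using balint q by simp
    finally show ?thesis .
  qed
  have hadd: "h (x + y) = h x + h y" if xy: "x \<in> rat_real.span \<Gamma>" "y \<in> rat_real.span \<Gamma>" for x y
  proof -
    define n where "n = N x * N y"
    have n: "n > 0" "of_nat n * x \<in> \<Gamma>" "of_nat n * y \<in> \<Gamma>"
      using N[OF xy(1)] N[OF xy(2)] natG[of "of_nat (N x) * x" "N y"] natG[of "of_nat (N y) * y" "N x"]
      by (auto simp: n_def algebra_simps)
    have "h (x + y) = f (of_nat n * x + of_nat n * y) (1 / of_nat n)"
      using h[OF n(1), of "x + y"] G(2)[OF n(2,3)] by (simp add: distrib_left)
    then show ?thesis using h[OF n(1,2)] h[OF n(1,3)] addl[OF n(2,3)] by simp
  qed
  show ?thesis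
  proof (intro ex1I[of _ h] conjI ballI allI)
    show "h \<in> extensional (rat_real.span \<Gamma>)" by (simp add: h_def)
  next
    fix k assume k: "k \<in> extensional (rat_real.span \<Gamma>)
      \<and> (\<forall>x\<in>rat_real.span \<Gamma>. \<forall>y\<in>rat_real.span \<Gamma>. k (x + y) = k x + k y)
      \<and> (\<forall>x\<in>\<Gamma>. \<forall>q. k (of_rat q * x) = f x q)"
    show "k = h"
    proof (rule extensionalityI[of _ "rat_real.span \<Gamma>"])
      fix x assume x: "x \<in> rat_real.span \<Gamma>"
      define y q where "y = of_nat (N x) * x" and "q = (1 / of_nat (N x) :: rat)"
      have xy: "x = of_rat q * y" and y: "y \<in> \<Gamma>"
        using N[OF x] by (simp_all add: of_rat_divide y_def q_def)
      have "k (of_rat q * y) = f y q" using k y by blast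
      then show "k x = h x" using hq[OF y, of q] xy by metis
    qed (use k in \<open>auto simp: h_def\<close>)
  qed (use hq hadd in auto)
qed


section \<open>The space \<open>\<real>\<^sub>\<Gamma>\<close>\<close>

text \<open>
  \<open>Lft t\<close> and \<open>Rgt t\<close> stand for \<open>t\<^sub>-\<close> and \<open>t\<^sub>+\<close>, and \<open>Pt x\<close> for an unsplit point. The order on
  the whole type is lexicographic with \<open>Lft t < Pt t < Rgt t\<close>; for a given \<open>\<Gamma>\<close> only the
  elements of \<open>split_line \<Gamma>\<close> matter.
\<close>

datatype split_real = Lft real | Pt real | Rgt real

primrec q_pt :: "split_real \<Rightarrow> real" where
  "q_pt (Lft t) = t" | "q_pt (Pt t) = t" | "q_pt (Rgt t) = t"

primrec side :: "split_real \<Rightarrow> int" where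
  "side (Lft t) = -1" | "side (Pt t) = 0" | "side (Rgt t) = 1"

instantiation split_real :: linorder
begin

definition less_split_real :: "split_real \<Rightarrow> split_real \<Rightarrow> bool"
  where "x < y \<longleftrightarrow> q_pt x < q_pt y \<or> (q_pt x = q_pt y \<and> side x < side y)"

definition less_eq_split_real :: "split_real \<Rightarrow> split_real \<Rightarrow> bool"
  where "x \<le> y \<longleftrightarrow> x = y \<or> x < (y::split_real)"

instance
proof
  fix x y z :: split_real
  show "x < y \<longleftrightarrow> x \<le> y \<and> \<not> y \<le> x"
    by (auto simp: less_split_real_def less_eq_split_real_def)
  show "x \<le> x" by (simp add: less_eq_split_real_def)
  show "x \<le> y \<Longrightarrow> y \<le> z \<Longrightarrow> x \<le> z" "x \<le> y \<Longrightarrow> y \<le> x \<Longrightarrow> x = y"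
    by (auto simp: less_split_real_def less_eq_split_real_def)
  show "x \<le> y \<or> y \<le> x"
    by (cases x; cases y) (auto simp: less_split_real_def less_eq_split_real_def)
qed

end

definition split_line :: "real set \<Rightarrow> split_real set"
  where "split_line \<Gamma> = Pt ` (- \<Gamma>) \<union> Lft ` \<Gamma> \<union> Rgt ` \<Gamma>"

text \<open>
  The order topology of the ordered set \<open>A\<close> itself, which in general is coarser than the
  subspace topology that \<open>A\<close> would inherit from the order topology of the type.
\<close>

definition order_topology_on :: "'a::linorder set \<Rightarrow> 'a topology"
  where "order_topology_on A = topology_generated_by
    (insert A ((\<lambda>a. {x \<in> A. x < a}) ` A \<union> (\<lambda>a. {x \<in> A. a < x}) ` A))"

lemma topspace_order_topology_on [simp]: "topspace (order_topology_on A) = A"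
  by (auto simp: order_topology_on_def)

definition split_line_top :: "real set \<Rightarrow> split_real topology"
  where "split_line_top \<Gamma> = order_topology_on (split_line \<Gamma>)"


section \<open>The group \<open>\<Gamma> \<rtimes> \<Lambda>\<close> and its action on \<open>\<real>\<^sub>\<Gamma>\<close>\<close>

definition affine_group :: "real set \<Rightarrow> real set \<Rightarrow> (real \<times> real) monoid"
  where "affine_group \<Gamma> \<Lambda> = \<lparr>carrier = \<Gamma> \<times> \<Lambda>,
    monoid.mult = (\<lambda>(s, l) (s', l'). (s + l * s', l * l')), one = (0, 1)\<rparr>"

fun affine_act :: "real \<times> real \<Rightarrow> split_real \<Rightarrow> split_real" where
  "affine_act (s, l) (Pt x) = Pt (l * x + s)"
| "affine_act (s, l) (Lft t) = Lft (l * t + s)"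
| "affine_act (s, l) (Rgt t) = Rgt (l * t + s)"

lemma pos_real_subgroupD:
  assumes "subgroup \<Lambda> pos_real_mult_group"
  shows "\<And>x. x \<in> \<Lambda> \<Longrightarrow> 0 < x" "1 \<in> \<Lambda>" "\<And>x y. x \<in> \<Lambda> \<Longrightarrow> y \<in> \<Lambda> \<Longrightarrow> x * y \<in> \<Lambda>"
    "\<And>x. x \<in> \<Lambda> \<Longrightarrow> inverse x \<in> \<Lambda>"
proof -
  interpret P: group pos_real_mult_group
  proof (rule groupI)
    show "\<exists>y\<in>carrier pos_real_mult_group. y \<otimes>\<^bsub>pos_real_mult_group\<^esub> x = \<one>\<^bsub>pos_real_mult_group\<^esub>"
      if "x \<in> carrier pos_real_mult_group" for x
      using that by (intro bexI[of _ "inverse x"]) (simp_all add: pos_real_mult_group_def)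
  qed (simp_all add: pos_real_mult_group_def)
  show pos: "\<And>x. x \<in> \<Lambda> \<Longrightarrow> 0 < x"
    using subgroup.subset[OF assms] by (auto simp: pos_real_mult_group_def)
  show "1 \<in> \<Lambda>" "\<And>x y. x \<in> \<Lambda> \<Longrightarrow> y \<in> \<Lambda> \<Longrightarrow> x * y \<in> \<Lambda>"
    using subgroup.one_closed[OF assms] subgroup.m_closed[OF assms]
    by (auto simp: pos_real_mult_group_def)
  fix x assume x: "x \<in> \<Lambda>"
  have "inv\<^bsub>pos_real_mult_group\<^esub> x = inverse x"
    using pos[OF x] by (intro P.inv_equality) (auto simp: pos_real_mult_group_def)
  then show "inverse x \<in> \<Lambda>" using subgroup.m_inv_closed[OF assms x] by simp
qed

lemma group_affine_group:
  assumes \<Lambda>: "subgroup \<Lambda> pos_real_mult_group" and \<Gamma>: "ZL_module \<Lambda> \<Gamma>"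
  shows "group (affine_group \<Gamma> \<Lambda>)"
proof -
  have G: "subgroup \<Gamma> real_add_group" and L: "\<And>l t. l \<in> \<Lambda> \<Longrightarrow> t \<in> \<Gamma> \<Longrightarrow> l * t \<in> \<Gamma>"
    using \<Gamma> by (auto simp: ZL_module_def)
  note g = real_subgroupD[OF G] and l = pos_real_subgroupD[OF \<Lambda>]
  show ?thesis
  proof (rule groupI)
    fix x assume "x \<in> carrier (affine_group \<Gamma> \<Lambda>)"
    then obtain s m where x: "x = (s, m)" "s \<in> \<Gamma>" "m \<in> \<Lambda>" by (auto simp: affine_group_def)
    show "\<exists>y\<in>carrier (affine_group \<Gamma> \<Lambda>). y \<otimes>\<^bsub>affine_group \<Gamma> \<Lambda>\<^esub> x = \<one>\<^bsub>affine_group \<Gamma> \<Lambda>\<^esub>"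
      using x g(3)[OF L[OF l(4)[OF x(3)] x(2)]] l(4)[OF x(3)] l(1)[OF x(3)]
      by (intro bexI[of _ "(- (inverse m * s), inverse m)"]) (auto simp: affine_group_def)
  qed (auto simp: affine_group_def g(1,2) l(2,3) L distrib_left mult.assoc add.assoc)
qed

lemma affine_act_split_line:
  assumes \<Lambda>: "subgroup \<Lambda> pos_real_mult_group" and \<Gamma>: "ZL_module \<Lambda> \<Gamma>"
    and g: "g \<in> carrier (affine_group \<Gamma> \<Lambda>)" and x: "x \<in> split_line \<Gamma>"
  shows "affine_act g x \<in> split_line \<Gamma>"
proof -
  have G: "subgroup \<Gamma> real_add_group" and L: "\<And>l t. l \<in> \<Lambda> \<Longrightarrow> t \<in> \<Gamma> \<Longrightarrow> l * t \<in> \<Gamma>"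
    using \<Gamma> by (auto simp: ZL_module_def)
  note gg = real_subgroupD[OF G] and l = pos_real_subgroupD[OF \<Lambda>]
  obtain s m where sm: "g = (s, m)" "s \<in> \<Gamma>" "m \<in> \<Lambda>" using g by (auto simp: affine_group_def)
  have "0 < m" "inverse m \<in> \<Lambda>" using l(1,4)[OF sm(3)] .
  have fwd: "m * t + s \<in> \<Gamma>" if "t \<in> \<Gamma>" for t
    using gg(2)[OF L[OF sm(3) that] sm(2)] .
  have bwd: "t \<in> \<Gamma>" if "m * t + s \<in> \<Gamma>" for t
  proof -
    have "inverse m * ((m * t + s) + - s) \<in> \<Gamma>"
      by (rule L[OF \<open>inverse m \<in> \<Lambda>\<close> gg(2)[OF that gg(3)[OF sm(2)]]])
    moreover have "inverse m * ((m * t + s) + - s) = t" using \<open>0 < m\<close> by simp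
    ultimately show ?thesis by (simp only:)
  qed
  show ?thesis
  proof (cases x)
    case (Pt t)
    then have "t \<notin> \<Gamma>" using x by (auto simp: split_line_def)
    then have "m * t + s \<notin> \<Gamma>" using bwd by blast
    then show ?thesis using Pt by (simp add: split_line_def sm(1))
  next
    case (Lft t)
    then have "t \<in> \<Gamma>" using x by (auto simp: split_line_def)
    then show ?thesis using Lft fwd by (simp add: split_line_def sm(1))
  next
    case (Rgt t)
    then have "t \<in> \<Gamma>" using x by (auto simp: split_line_def)
    then show ?thesis using Rgt fwd by (simp add: split_line_def sm(1))
  qed
qed

lemma affine_act_mult:
  "affine_act (g \<otimes>\<^bsub>affine_group \<Gamma> \<Lambda>\<^esub> h) x = affine_act g (affine_act h x)"
  by (cases g; cases h; cases x) (auto simp: affine_group_def algebra_simps)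

lemma affine_act_one: "affine_act \<one>\<^bsub>affine_group \<Gamma> \<Lambda>\<^esub> x = x"
  by (cases x) (auto simp: affine_group_def)


section \<open>Topological groupoids and their first cohomology\<close>

text \<open>
  A groupoid is given by its arrow space, its unit space (a subset of the arrows), and the
  range, source and composition maps; \<open>gcomp g h\<close> is meaningful when \<open>src g = rng h\<close>.
  Inverses are determined by these data and are not recorded.
\<close>

record 'a top_groupoid =
  arrows :: "'a topology"
  units :: "'a set"
  rng :: "'a \<Rightarrow> 'a"
  src :: "'a \<Rightarrow> 'a"
  gcomp :: "'a \<Rightarrow> 'a \<Rightarrow> 'a"

text \<open>
  Maps on the arrow space are taken to be \<open>undefined\<close> outside it, so that equality of
  cocycles is equality of functions.
\<close>

definition Z1 :: "'a top_groupoid \<Rightarrow> ('a \<Rightarrow> int) monoid"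
  where "Z1 \<G> = \<lparr>
    carrier = {\<xi> \<in> extensional (topspace (arrows \<G>)).
      continuous_map (arrows \<G>) (discrete_topology UNIV) \<xi> \<and>
      (\<forall>g \<in> topspace (arrows \<G>). \<forall>h \<in> topspace (arrows \<G>).
         src \<G> g = rng \<G> h \<longrightarrow> \<xi> (gcomp \<G> g h) = \<xi> g + \<xi> h)},
    monoid.mult = (\<lambda>\<xi> \<eta>. restrict (\<lambda>g. \<xi> g + \<eta> g) (topspace (arrows \<G>))),
    one = restrict (\<lambda>g. 0) (topspace (arrows \<G>))\<rparr>"

definition B1 :: "'a top_groupoid \<Rightarrow> ('a \<Rightarrow> int) set"
  where "B1 \<G> = {\<xi> \<in> carrier (Z1 \<G>).
    \<exists>f. continuous_map (subtopology (arrows \<G>) (units \<G>)) (discrete_topology UNIV) f \<and>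
      (\<forall>g \<in> topspace (arrows \<G>). \<xi> g = f (rng \<G> g) - f (src \<G> g))}"

definition H1 :: "'a top_groupoid \<Rightarrow> ('a \<Rightarrow> int) set monoid"
  where "H1 \<G> = Z1 \<G> Mod B1 \<G>"

text \<open>The map \<open>[\<xi>] \<mapsto> [\<xi> \<circ> \<rho>]\<close> induced by a homomorphism \<open>\<rho>\<close> from \<open>\<G>\<close> to \<open>\<H>\<close>.\<close>

definition H1_map ::
    "'a top_groupoid \<Rightarrow> 'b top_groupoid \<Rightarrow> ('a \<Rightarrow> 'b) \<Rightarrow> ('b \<Rightarrow> int) set \<Rightarrow> ('a \<Rightarrow> int) set"
  where "H1_map \<G> \<H> \<rho> c =
    the_elem ((\<lambda>\<xi>. B1 \<G> #>\<^bsub>Z1 \<G>\<^esub> restrict (\<xi> \<circ> \<rho>) (topspace (arrows \<G>))) ` c)"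

lemma continuous_map_discrete_binop:
  assumes "continuous_map X (discrete_topology UNIV) f" "continuous_map X (discrete_topology UNIV) g"
  shows "continuous_map X (discrete_topology UNIV) (\<lambda>x. F (f x) (g x))"
proof -
  have "continuous_map X (prod_topology (discrete_topology UNIV) (discrete_topology UNIV)) (\<lambda>x. (f x, g x))"
    using assms by (simp add: continuous_map_pairedI)
  then have "continuous_map X (discrete_topology UNIV) (\<lambda>x. (f x, g x))"
    by (simp flip: prod_topology_discrete_topology)
  moreover have "continuous_map (discrete_topology UNIV) (discrete_topology UNIV) (\<lambda>(a, b). F a b)"
    by simp
  ultimately have "continuous_map X (discrete_topology UNIV) ((\<lambda>(a, b). F a b) \<circ> (\<lambda>x. (f x, g x)))"
    by (rule continuous_map_compose)
  then show ?thesis by (simp add: o_def)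
qed

lemma Z1_restrict_memI:
  assumes "continuous_map (arrows \<G>) (discrete_topology UNIV) \<xi>"
    and "\<And>g h. g \<in> topspace (arrows \<G>) \<Longrightarrow> h \<in> topspace (arrows \<G>) \<Longrightarrow> src \<G> g = rng \<G> h \<Longrightarrow>
      gcomp \<G> g h \<in> topspace (arrows \<G>) \<and> \<xi> (gcomp \<G> g h) = \<xi> g + \<xi> h"
  shows "restrict \<xi> (topspace (arrows \<G>)) \<in> carrier (Z1 \<G>)"
  using assms continuous_map_eq[OF assms(1), of "restrict \<xi> (topspace (arrows \<G>))"]
  by (auto simp: Z1_def)

lemma comm_group_Z1:
  assumes cl: "\<And>g h. g \<in> topspace (arrows \<G>) \<Longrightarrow> h \<in> topspace (arrows \<G>) \<Longrightarrow>
    src \<G> g = rng \<G> h \<Longrightarrow> gcomp \<G> g h \<in> topspace (arrows \<G>)"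
  shows "comm_group (Z1 \<G>)"
proof (rule comm_groupI)
  let ?A = "topspace (arrows \<G>)"
  have mult: "\<xi> \<otimes>\<^bsub>Z1 \<G>\<^esub> \<eta> = restrict (\<lambda>g. \<xi> g + \<eta> g) ?A" for \<xi> \<eta>
    by (simp add: Z1_def)
  have one: "\<one>\<^bsub>Z1 \<G>\<^esub> = restrict (\<lambda>g. 0) ?A" by (simp add: Z1_def)
  show "\<one>\<^bsub>Z1 \<G>\<^esub> \<in> carrier (Z1 \<G>)"
    unfolding one by (rule Z1_restrict_memI) (auto intro: cl)
  fix \<xi> assume x: "\<xi> \<in> carrier (Z1 \<G>)"
  have xe: "restrict \<xi> ?A = \<xi>" using x by (auto simp: Z1_def extensional_restrict)
  show "\<one>\<^bsub>Z1 \<G>\<^esub> \<otimes>\<^bsub>Z1 \<G>\<^esub> \<xi> = \<xi>"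
    unfolding mult one by (subst (2) xe[symmetric], rule restrict_ext) auto
  have "restrict (\<lambda>g. - \<xi> g) ?A \<in> carrier (Z1 \<G>)"
    using x continuous_map_discrete_binop[of "arrows \<G>" \<xi> \<xi> "\<lambda>a b. - a"]
    by (intro Z1_restrict_memI) (auto simp: Z1_def intro: cl)
  then show "\<exists>y\<in>carrier (Z1 \<G>). y \<otimes>\<^bsub>Z1 \<G>\<^esub> \<xi> = \<one>\<^bsub>Z1 \<G>\<^esub>"
    by (intro bexI[of _ "restrict (\<lambda>g. - \<xi> g) ?A"]) (auto simp: mult one)
  fix \<eta> assume y: "\<eta> \<in> carrier (Z1 \<G>)"
  show "\<xi> \<otimes>\<^bsub>Z1 \<G>\<^esub> \<eta> \<in> carrier (Z1 \<G>)"
    unfolding mult using x y continuous_map_discrete_binop[of "arrows \<G>" \<xi> \<eta> "(+)"]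
    by (intro Z1_restrict_memI) (auto simp: Z1_def intro: cl)
  show "\<xi> \<otimes>\<^bsub>Z1 \<G>\<^esub> \<eta> = \<eta> \<otimes>\<^bsub>Z1 \<G>\<^esub> \<xi>"
    by (simp add: Z1_def add.commute)
  show "\<xi> \<otimes>\<^bsub>Z1 \<G>\<^esub> \<eta> \<otimes>\<^bsub>Z1 \<G>\<^esub> \<zeta> = \<xi> \<otimes>\<^bsub>Z1 \<G>\<^esub> (\<eta> \<otimes>\<^bsub>Z1 \<G>\<^esub> \<zeta>)" for \<zeta>
    unfolding mult by (rule restrict_ext) simp
qed

lemma subgroup_B1:
  assumes cl: "\<And>g h. g \<in> topspace (arrows \<G>) \<Longrightarrow> h \<in> topspace (arrows \<G>) \<Longrightarrow>
    src \<G> g = rng \<G> h \<Longrightarrow> gcomp \<G> g h \<in> topspace (arrows \<G>)"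
  shows "subgroup (B1 \<G>) (Z1 \<G>)"
proof -
  let ?A = "topspace (arrows \<G>)" and ?U = "subtopology (arrows \<G>) (units \<G>)"
  interpret Z: comm_group "Z1 \<G>" by (rule comm_group_Z1[OF cl])
  have mult: "\<xi> \<otimes>\<^bsub>Z1 \<G>\<^esub> \<eta> = restrict (\<lambda>g. \<xi> g + \<eta> g) ?A" for \<xi> \<eta>
    by (simp add: Z1_def)
  have one: "\<one>\<^bsub>Z1 \<G>\<^esub> = restrict (\<lambda>g. 0) ?A" by (simp add: Z1_def)
  show ?thesis
  proof (rule Z.subgroupI)
    show "B1 \<G> \<subseteq> carrier (Z1 \<G>)" by (auto simp: B1_def)
    have "\<one>\<^bsub>Z1 \<G>\<^esub> \<in> B1 \<G>"
      unfolding B1_def using Z.one_closed by (auto simp: one intro: exI[of _ "\<lambda>_. 0"])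
    then show "B1 \<G> \<noteq> {}" by blast
  next
    fix \<xi> assume "\<xi> \<in> B1 \<G>"
    then obtain f where f: "\<xi> \<in> carrier (Z1 \<G>)" "continuous_map ?U (discrete_topology UNIV) f"
      "\<forall>g\<in>?A. \<xi> g = f (rng \<G> g) - f (src \<G> g)" by (auto simp: B1_def)
    have "(inv\<^bsub>Z1 \<G>\<^esub> \<xi>) g = - \<xi> g" if "g \<in> ?A" for g
    proof -
      have "(inv\<^bsub>Z1 \<G>\<^esub> \<xi> \<otimes>\<^bsub>Z1 \<G>\<^esub> \<xi>) g = \<one>\<^bsub>Z1 \<G>\<^esub> g" using f by simp
      then show ?thesis using that by (simp add: mult one)
    qed
    moreover have "continuous_map ?U (discrete_topology UNIV) (\<lambda>x. - f x)"
      using continuous_map_discrete_binop[OF f(2,2), of "\<lambda>a b. - a"] by simp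
    ultimately show "inv\<^bsub>Z1 \<G>\<^esub> \<xi> \<in> B1 \<G>"
      using f Z.inv_closed[OF f(1)] unfolding B1_def by (auto intro!: exI[of _ "\<lambda>x. - f x"])
  next
    fix \<xi> \<eta> assume "\<xi> \<in> B1 \<G>" "\<eta> \<in> B1 \<G>"
    then obtain f k where f: "\<xi> \<in> carrier (Z1 \<G>)" "continuous_map ?U (discrete_topology UNIV) f"
      "\<forall>g\<in>?A. \<xi> g = f (rng \<G> g) - f (src \<G> g)"
      and k: "\<eta> \<in> carrier (Z1 \<G>)" "continuous_map ?U (discrete_topology UNIV) k"
      "\<forall>g\<in>?A. \<eta> g = k (rng \<G> g) - k (src \<G> g)" by (auto simp: B1_def)
    show "\<xi> \<otimes>\<^bsub>Z1 \<G>\<^esub> \<eta> \<in> B1 \<G>"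
      using f k Z.m_closed[OF f(1) k(1)] continuous_map_discrete_binop[OF f(2) k(2), of "(+)"]
      unfolding B1_def by (auto simp: mult intro!: exI[of _ "\<lambda>x. f x + k x"])
  qed
qed

lemma comm_group_H1:
  assumes cl: "\<And>g h. g \<in> topspace (arrows \<G>) \<Longrightarrow> h \<in> topspace (arrows \<G>) \<Longrightarrow>
    src \<G> g = rng \<G> h \<Longrightarrow> gcomp \<G> g h \<in> topspace (arrows \<G>)"
  shows "comm_group (H1 \<G>)"
  unfolding H1_def
  by (rule comm_group.abelian_FactGroup[OF comm_group_Z1[OF cl] subgroup_B1[OF cl]])


section \<open>Groups and transformation groupoids\<close>

definition group_groupoid :: "('g, 'm) monoid_scheme \<Rightarrow> 'g top_groupoid"
  where "group_groupoid G = \<lparr>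
    arrows = discrete_topology (carrier G),
    units = {\<one>\<^bsub>G\<^esub>},
    rng = (\<lambda>_. \<one>\<^bsub>G\<^esub>),
    src = (\<lambda>_. \<one>\<^bsub>G\<^esub>),
    gcomp = (\<lambda>g h. g \<otimes>\<^bsub>G\<^esub> h)\<rparr>"

text \<open>A unit \<open>x\<close> of the transformation groupoid is the arrow \<open>(x, \<one>)\<close>.\<close>

definition transformation_groupoid ::
    "'x topology \<Rightarrow> ('g, 'm) monoid_scheme \<Rightarrow> ('g \<Rightarrow> 'x \<Rightarrow> 'x) \<Rightarrow> ('x \<times> 'g) top_groupoid"
  where "transformation_groupoid X G act = \<lparr>
    arrows = prod_topology X (discrete_topology (carrier G)),
    units = topspace X \<times> {\<one>\<^bsub>G\<^esub>},
    rng = (\<lambda>(x, \<gamma>). (x, \<one>\<^bsub>G\<^esub>)),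
    src = (\<lambda>(x, \<gamma>). (act (inv\<^bsub>G\<^esub> \<gamma>) x, \<one>\<^bsub>G\<^esub>)),
    gcomp = (\<lambda>(x, \<gamma>) (y, \<gamma>'). (x, \<gamma> \<otimes>\<^bsub>G\<^esub> \<gamma>'))\<rparr>"

text \<open>
  The natural homomorphism to the group is \<open>snd\<close>. The lemmas after the definition identify
  the first cohomology of the group, viewed as a groupoid, with its homomorphisms to the integers.
\<close>

definition H1_rigid :: "'x topology \<Rightarrow> ('g, 'm) monoid_scheme \<Rightarrow> ('g \<Rightarrow> 'x \<Rightarrow> 'x) \<Rightarrow> bool"
  where "H1_rigid X G act \<longleftrightarrow>
    H1_map (transformation_groupoid X G act) (group_groupoid G) snd
      \<in> iso (H1 (group_groupoid G)) (H1 (transformation_groupoid X G act))"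

lemma carrier_Z1_group_groupoid:
  "carrier (Z1 (group_groupoid G)) = hom G integer_group \<inter> extensional (carrier G)"
  by (auto simp: Z1_def group_groupoid_def hom_def integer_group_def)

lemma B1_group_groupoid:
  assumes "group G"
  shows "B1 (group_groupoid G) = {\<one>\<^bsub>Z1 (group_groupoid G)\<^esub>}"
proof -
  interpret group G by fact
  have "comm_group (Z1 (group_groupoid G))"
    by (rule comm_group_Z1) (auto simp: group_groupoid_def)
  then interpret Z: comm_group "Z1 (group_groupoid G)" .
  have "\<xi> = \<one>\<^bsub>Z1 (group_groupoid G)\<^esub>" if "\<xi> \<in> B1 (group_groupoid G)" for \<xi>
    using that by (intro extensionalityI[of _ "carrier G"]) (auto simp: B1_def Z1_def group_groupoid_def)
  moreover have "\<one>\<^bsub>Z1 (group_groupoid G)\<^esub> \<in> B1 (group_groupoid G)"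
    using subgroup.one_closed[OF subgroup_B1[of "group_groupoid G"]] by (auto simp: group_groupoid_def)
  ultimately show ?thesis by blast
qed

lemma comm_group_H1_transformation_groupoid:
  assumes "group G"
  shows "comm_group (H1 (transformation_groupoid X G act))"
proof -
  interpret group G by fact
  show ?thesis by (rule comm_group_H1) (auto simp: transformation_groupoid_def)
qed

end

theory Submission
  imports Defs
begin

text \<open>
  A cocycle \<open>\<xi>\<close> has to be corrected by a coboundary so that \<open>\<xi> (x, \<gamma>)\<close> no longer depends on \<open>x\<close>; it
  is then a homomorphism in \<open>\<gamma>\<close>. What detects dependence on \<open>x\<close> is the jump
  \<open>F (t\<^sub>+) - F (t\<^sub>-)\<close> of a locally constant function \<open>F\<close> at the points \<open>t\<close> of \<open>\<Gamma>\<close>: there are finitely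
  many jumps in a bounded interval, and a function without jumps is constant, as the real line
  is connected (\<open>finite_jumps\<close>, \<open>no_jumps_imp_const\<close>).

  The main case is that of the translations (\<open>translation_cocycle_cohomologous_to_const\<close>). As the
  rank is at least \<open>2\<close>, there are \<open>a > 0\<close> and \<open>b\<close> in \<open>\<Gamma>\<close> independent over the rationals. The
  translation by \<open>a\<close> has a clopen fundamental domain, so the cocycle may be taken to be trivial on
  \<open>a\<int>\<close> and thus \<open>a\<close>-periodic. Its jumps at \<open>t\<close> are \<open>h t - h (t - s)\<close> for a function \<open>h\<close> on \<open>\<Gamma>/a\<int>\<close>,
  and for each \<open>s\<close> they are finite in number. Moreover, they add up to \<open>0\<close>, because the jumps of
  a periodic function cancel over a period. Looking at the two ends of the orbits of translation
  by \<open>b\<close> one finds that \<open>h\<close> is constant off a finite set (\<open>almost_invariant_periodic_eq_const\<close>). For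
  rank one this fails, since then the orbits are finite. So \<open>h\<close> is, up to a constant, the jump
  function of a finite sum of floor functions, and subtracting the coboundary of that sum
  leaves a cocycle without jumps.

  The scalars in \<open>\<Lambda>\<close> normalise the translations, hence for such a scalar \<open>l\<close> the function
  \<open>\<xi> (x, (0, l))\<close> changes by a constant under each translation. This forces it to be constant,
  since otherwise it would jump at every point of the dense set \<open>\<Gamma>\<close>
  (\<open>loc_const_equivariant_imp_const\<close>). The same fact shows that a homomorphism which is a
  coboundary of \<open>f\<close> vanishes, as \<open>f\<close> must be constant.
\<close>

section \<open>Orbits of a translation modulo a period\<close>

lemma finite_int_bound:
  assumes "finite (S::int set)"
  shows "\<exists>M\<ge>0. \<forall>n\<in>S. \<bar>n\<bar> \<le> M"
proof (intro exI conjI ballI)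
  show "0 \<le> Max (insert 0 (abs ` S))" using assms by simp
  show "\<bar>n\<bar> \<le> Max (insert 0 (abs ` S))" if "n \<in> S" for n using assms that by simp
qed

text \<open>
  The representative of \<open>t\<close> modulo \<open>a\<close> in \<open>[0, a)\<close>. Functions on \<open>\<Gamma>/a\<int>\<close> are handled as
  \<open>a\<close>-periodic functions on \<open>\<Gamma>\<close>, and finiteness in the quotient as finiteness in \<open>[0, a)\<close>.
\<close>
definition residue :: "real \<Rightarrow> real \<Rightarrow> real"
  where "residue a t = t - of_int \<lfloor>t / a\<rfloor> * a"

lemma residue_bounds: "0 < a \<Longrightarrow> 0 \<le> residue a t" "0 < a \<Longrightarrow> residue a t < a"
proof -
  assume a: "0 < a"
  show "0 \<le> residue a t" "residue a t < a"
    using floor_divide_lower[OF a, of t] floor_divide_upper[OF a, of t]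
    by (simp_all add: residue_def algebra_simps)
qed

lemma residue_cong: "0 < a \<Longrightarrow> t = u + of_int m * a \<Longrightarrow> residue a t = residue a u"
  by (simp add: residue_def add_divide_distrib algebra_simps)

lemma residue_id: "0 \<le> t \<Longrightarrow> t < a \<Longrightarrow> residue a t = t"
proof -
  assume t: "0 \<le> t" "t < a"
  then have "\<lfloor>t / a\<rfloor> = 0" by (simp add: floor_eq_iff)
  then show ?thesis by (simp add: residue_def)
qed

lemma residue_eqD: "residue a t = residue a u \<Longrightarrow> \<exists>m::int. t = u + of_int m * a"
  by (rule exI[of _ "\<lfloor>t / a\<rfloor> - \<lfloor>u / a\<rfloor>"]) (simp add: residue_def algebra_simps)

lemma periodic_add_int_mult:
  assumes \<Gamma>: "subgroup \<Gamma> real_add_group" and a: "a \<in> \<Gamma>"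
    and per: "\<And>t. t \<in> \<Gamma> \<Longrightarrow> h (t + a) = h t" and t: "t \<in> \<Gamma>"
  shows "h (t + of_int m * a) = h t"
proof (induction m rule: int_induct[where k = 0])
  note G = real_subgroupD(2)[OF \<Gamma> t real_subgroup_of_int_mult[OF \<Gamma> a]]
  case (step1 i)
  then show ?case using per[OF G[of i]] by (simp add: algebra_simps)
next
  note G = real_subgroupD(2)[OF \<Gamma> t real_subgroup_of_int_mult[OF \<Gamma> a]]
  case (step2 i)
  then show ?case using per[OF G[of "i - 1"]] by (simp add: algebra_simps)
qed simp

lemma periodic_residue:
  assumes "subgroup \<Gamma> real_add_group" "a \<in> \<Gamma>" "\<And>t. t \<in> \<Gamma> \<Longrightarrow> h (t + a) = h t" "t \<in> \<Gamma>"
  shows "h (residue a t) = h t"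
  using periodic_add_int_mult[where h = h, OF assms, of "- \<lfloor>t / a\<rfloor>"] by (simp add: residue_def)

text \<open>
  In the group \<open>A = \<Gamma>/a\<int>\<close> the class of \<open>b\<close> has infinite order, and \<open>h\<close> is a function on \<open>A\<close>
  that every translation changes at finitely many points only. Hence \<open>h\<close> is eventually constant
  in both directions along each orbit of translation by \<open>b\<close>, and the two end values \<open>cp\<close> and \<open>cm\<close>
  are the same for all orbits, because a translation carrying one orbit to another changes \<open>h\<close>
  finitely often. If \<open>A\<close> has two ends, as it does for \<open>\<Gamma> = \<int> + \<theta>\<int>\<close> and \<open>a = 1\<close>, the end values may
  differ a priori. The sum condition excludes this: each of the finitely many orbits on which \<open>h\<close>
  is not constant contributes the telescoping sum \<open>cp - cm\<close> to a total of \<open>0\<close>.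
\<close>

lemma almost_invariant_periodic_eq_const:
  fixes h :: "real \<Rightarrow> int" and a b :: real
  assumes \<Gamma>: "subgroup \<Gamma> real_add_group" and a: "a \<in> \<Gamma>" "0 < a" and b: "b \<in> \<Gamma>"
    and indep: "\<And>m n::int. of_int m * a = of_int n * b \<Longrightarrow> n = 0"
    and per: "\<And>t. t \<in> \<Gamma> \<Longrightarrow> h (t + a) = h t"
    and fin: "\<And>s. s \<in> \<Gamma> \<Longrightarrow> finite {t \<in> \<Gamma>. 0 \<le> t \<and> t < a \<and> h t \<noteq> h (t - s)}"
    and sum0: "(\<Sum>t | t \<in> \<Gamma> \<and> 0 \<le> t \<and> t < a \<and> h t \<noteq> h (t - b). h t - h (t - b)) = 0"
  shows "\<exists>c. finite {t \<in> \<Gamma>. 0 \<le> t \<and> t < a \<and> h t \<noteq> c}"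
proof -
  note add = real_subgroupD(2)[OF \<Gamma>] and neg = real_subgroupD(3)[OF \<Gamma>]
    and mult = real_subgroup_of_int_mult[OF \<Gamma>]
  have diff: "x - y \<in> \<Gamma>" if "x \<in> \<Gamma>" "y \<in> \<Gamma>" for x y using add[OF that(1) neg[OF that(2)]] by simp
  have red: "residue a t \<in> \<Gamma>" if "t \<in> \<Gamma>" for t
    unfolding residue_def by (intro diff mult that a)
  have perm: "h (t + of_int m * a) = h t" if "t \<in> \<Gamma>" for t m
    by (rule periodic_add_int_mult[where h = h, OF \<Gamma> a(1) per that])
  have hred: "h (residue a t) = h t" "h (residue a t - s) = h (t - s)" if "t \<in> \<Gamma>" "s \<in> \<Gamma>" for t s
  proof -
    show "h (residue a t) = h t"
      using perm[OF that(1), of "- \<lfloor>t / a\<rfloor>"] by (simp add: residue_def)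
    show "h (residue a t - s) = h (t - s)"
      using perm[OF diff[OF that], of "- \<lfloor>t / a\<rfloor>"] by (simp add: residue_def algebra_simps)
  qed
  define w where "w t n = t + of_int n * b" for t and n :: int
  have w: "w t n \<in> \<Gamma>" if "t \<in> \<Gamma>" for t n unfolding w_def by (intro add mult that b)
  have w0: "w t 0 = t" for t by (simp add: w_def)
  have ww: "w t n - b = w t (n - 1)" for t n by (simp add: w_def algebra_simps)
  have inj: "inj (\<lambda>n. residue a (w t n))" for t
  proof (rule injI)
    fix m n assume "residue a (w t m) = residue a (w t n)"
    then obtain k :: int where "w t m = w t n + of_int k * a" using residue_eqD by blast
    then have "of_int k * a = of_int (m - n) * b" by (simp add: w_def algebra_simps)
    then show "m = n" using indep by fastforce
  qed
  have fin_orbit: "finite {n. h (w t n) \<noteq> h (w t n - s)}" if "t \<in> \<Gamma>" "s \<in> \<Gamma>" for t s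
  proof (rule finite_imageD)
    show "inj_on (\<lambda>n. residue a (w t n)) {n. h (w t n) \<noteq> h (w t n - s)}"
      using inj by (rule inj_on_subset) simp
    show "finite ((\<lambda>n. residue a (w t n)) ` {n. h (w t n) \<noteq> h (w t n - s)})"
      by (rule finite_subset[OF _ fin[OF that(2)]])
        (use hred[OF w[OF that(1)] that(2)] red[OF w[OF that(1)]] residue_bounds[OF a(2)] in auto)
  qed
  \<comment> \<open>Beyond some \<open>M\<close> the differences along the orbit of \<open>t\<close> vanish.\<close>
  have tails: "\<exists>M\<ge>0. (\<forall>n\<ge>M. h (w t n) = h (w t M)) \<and> (\<forall>n < - M. h (w t n) = h (w t (- M - 1)))
     \<and> (\<forall>n. h (w t n) \<noteq> h (w t n - b) \<longrightarrow> \<bar>n\<bar> \<le> M)"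
    if t: "t \<in> \<Gamma>" for t
  proof -
    obtain M where M: "M \<ge> 0" "\<And>n. h (w t n) \<noteq> h (w t n - b) \<Longrightarrow> \<bar>n\<bar> \<le> M"
      using finite_int_bound[OF fin_orbit[OF t b]] by auto
    have up: "h (w t n) = h (w t M)" if "n \<ge> M" for n
      using that
    proof (induction n rule: int_ge_induct)
      case (step i)
      then show ?case using M(2)[of "i + 1"] M(1) ww[of t "i + 1"] by fastforce
    qed simp
    have down: "h (w t n) = h (w t (- M - 1))" if "n \<le> - M - 1" for n
      using that
    proof (induction n rule: int_le_induct)
      case (step i)
      then show ?case using M(2)[of i] M(1) ww[of t i] by fastforce
    qed simp
    have "h (w t n) = h (w t (- M - 1))" if "n < - M" for n
      by (rule down) (use that in simp)
    with M up show ?thesis by blast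
  qed
  obtain M0 where M0: "\<And>n. n \<ge> M0 \<Longrightarrow> h (w 0 n) = h (w 0 M0)"
      "\<And>n. n < - M0 \<Longrightarrow> h (w 0 n) = h (w 0 (- M0 - 1))"
    using tails[OF real_subgroupD(1)[OF \<Gamma>]] by blast
  define cp cm where "cp = h (w 0 M0)" and "cm = h (w 0 (- M0 - 1))"
  \<comment> \<open>The translation by \<open>t\<close> takes the orbit of \<open>0\<close> to that of \<open>t\<close> and changes \<open>h\<close> finitely often,
    so the end values of the former are also those of the latter.\<close>
  have ends: "\<exists>M\<ge>0. (\<forall>n\<ge>M. h (w t n) = cp) \<and> (\<forall>n < - M. h (w t n) = cm)
     \<and> (\<forall>n. h (w t n) \<noteq> h (w t n - b) \<longrightarrow> \<bar>n\<bar> \<le> M)" if t: "t \<in> \<Gamma>" for t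
  proof -
    obtain M where M: "M \<ge> 0" "\<And>n. n \<ge> M \<Longrightarrow> h (w t n) = h (w t M)"
        "\<And>n. n < - M \<Longrightarrow> h (w t n) = h (w t (- M - 1))"
        "\<And>n. h (w t n) \<noteq> h (w t n - b) \<Longrightarrow> \<bar>n\<bar> \<le> M"
      using tails[OF t] by blast
    obtain K where K: "K \<ge> 0" "\<And>n. h (w t n) \<noteq> h (w t n - t) \<Longrightarrow> \<bar>n\<bar> \<le> K"
      using finite_int_bound[OF fin_orbit[OF t t]] by auto
    have wt: "w t n - t = w 0 n" for n by (simp add: w_def)
    define n where "n = \<bar>M0\<bar> + M + K + 1"
    have "h (w t M) = cp"
      using M(2)[of n] K(2)[of n] M0(1)[of n] M(1) K(1) by (fastforce simp: n_def cp_def wt)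
    moreover have "h (w t (- M - 1)) = cm"
      using M(3)[of "- n"] K(2)[of "- n"] M0(2)[of "- n"] M(1) K(1) by (fastforce simp: n_def cm_def wt)
    ultimately show ?thesis using M by metis
  qed
  define D where "D t = h t - h (t - b)" for t
  define S where "S = {t \<in> \<Gamma>. 0 \<le> t \<and> t < a \<and> h t \<noteq> h (t - b)}"
  have S: "finite S" unfolding S_def by (rule fin[OF b])
  have sum_orbit: "(\<Sum>n | D (w t n) \<noteq> 0. D (w t n)) = cp - cm" if t: "t \<in> \<Gamma>" for t
  proof -
    obtain M where M: "M \<ge> 0" "\<And>n. n \<ge> M \<Longrightarrow> h (w t n) = cp" "\<And>n. n < - M \<Longrightarrow> h (w t n) = cm"
        "\<And>n. h (w t n) \<noteq> h (w t n - b) \<Longrightarrow> \<bar>n\<bar> \<le> M"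
      using ends[OF t] by blast
    have tel: "(\<Sum>n = l..k. D (w t n)) = h (w t k) - h (w t (l - 1))" if "k \<ge> l - 1" for k l
      using that
    proof (induction k rule: int_ge_induct)
      case (step i)
      have "{l..i + 1} = insert (i + 1) {l..i}" using step(1) by auto
      then show ?case using step by (simp add: D_def ww)
    qed simp
    have "(\<Sum>n | D (w t n) \<noteq> 0. D (w t n)) = (\<Sum>n = - M..M. D (w t n))"
    proof (rule sum.mono_neutral_left)
      show "{n. D (w t n) \<noteq> 0} \<subseteq> {- M..M}"
        using M(4) by (fastforce simp: D_def abs_le_iff)
    qed auto
    then show ?thesis using tel[of "- M" M] M(1,2) M(3)[of "- M - 1"] by simp
  qed
  \<comment> \<open>The orbits are taken modulo \<open>a\<close>, so that they partition the finite set \<open>S\<close>.\<close>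
  define orb where "orb t = range (\<lambda>n. residue a (w t n))" for t
  have self: "t \<in> orb t" if "t \<in> S" for t
    using that by (auto simp: orb_def S_def w0 residue_id intro!: image_eqI[where x = 0])
  have res_w: "residue a (w (residue a (w t m)) n) = residue a (w t (m + n))" for t m n
    by (rule residue_cong[OF a(2), of _ _ "- \<lfloor>w t m / a\<rfloor>"]) (simp add: residue_def w_def algebra_simps)
  have orb_eq: "orb s = orb t" if st: "s \<in> orb t" for s t
  proof -
    obtain m where m: "s = residue a (w t m)" using st by (auto simp: orb_def)
    have "orb s = (\<lambda>n. residue a (w t n)) ` range (\<lambda>n. m + n)"
      unfolding orb_def m res_w image_image ..
    also have "range (\<lambda>n. m + n) = UNIV" by (rule surj_plus)
    finally show ?thesis by (simp add: orb_def)
  qed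
  have cls: "(\<Sum>s | s \<in> S \<and> orb s = orb t. D s) = cp - cm" if t: "t \<in> S" for t
  proof -
    have tG: "t \<in> \<Gamma>" using t by (simp add: S_def)
    have eq: "{s. s \<in> S \<and> orb s = orb t} = (\<lambda>n. residue a (w t n)) ` {n. D (w t n) \<noteq> 0}"
    proof (intro equalityI subsetI)
      fix s assume "s \<in> {s. s \<in> S \<and> orb s = orb t}"
      then have s: "s \<in> S" "s \<in> orb t" using self by auto
      then obtain n where n: "s = residue a (w t n)" by (auto simp: orb_def)
      then have "D (w t n) \<noteq> 0" using s(1) hred[OF w[OF tG] b] by (simp add: S_def D_def)
      then show "s \<in> (\<lambda>n. residue a (w t n)) ` {n. D (w t n) \<noteq> 0}" using n by blast
    next
      fix s assume "s \<in> (\<lambda>n. residue a (w t n)) ` {n. D (w t n) \<noteq> 0}"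
      then obtain n where n: "s = residue a (w t n)" "D (w t n) \<noteq> 0" by blast
      then have "s \<in> S"
        using red[OF w[OF tG]] residue_bounds[OF a(2)] hred[OF w[OF tG] b] by (simp add: S_def D_def)
      moreover have "orb s = orb t" by (rule orb_eq) (use n in \<open>auto simp: orb_def\<close>)
      ultimately show "s \<in> {s. s \<in> S \<and> orb s = orb t}" by blast
    qed
    have "(\<Sum>s | s \<in> S \<and> orb s = orb t. D s) = (\<Sum>n | D (w t n) \<noteq> 0. D (residue a (w t n)))"
      unfolding eq using inj by (subst sum.reindex) (auto intro: inj_on_subset)
    also have "\<dots> = (\<Sum>n | D (w t n) \<noteq> 0. D (w t n))"
      using hred[OF w[OF tG] b] by (simp add: D_def)
    finally show ?thesis using sum_orbit[OF tG] by simp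
  qed
  have "0 = (\<Sum>t\<in>S. D t)" using sum0 by (simp add: S_def D_def)
  also have "\<dots> = (\<Sum>y\<in>orb ` S. \<Sum>s | s \<in> S \<and> orb s = y. D s)"
    by (rule sum.image_gen[OF S])
  also have "\<dots> = (\<Sum>y\<in>orb ` S. cp - cm)" by (rule sum.cong) (auto simp: cls)
  finally have "S = {} \<or> cp = cm" using S by simp
  moreover have "cp = cm" if "S = {}"
  proof -
    have "D (w 0 n) = 0" for n
    proof (rule ccontr)
      note z = w[OF real_subgroupD(1)[OF \<Gamma>]]
      assume "D (w 0 n) \<noteq> 0"
      then have "residue a (w 0 n) \<in> S"
        using red[OF z] residue_bounds[OF a(2)] hred[OF z b] by (simp add: S_def D_def)
      then show False using that by simp
    qed
    then show ?thesis using sum_orbit[OF real_subgroupD(1)[OF \<Gamma>]] by simp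
  qed
  ultimately have cpm: "cp = cm" by blast
  \<comment> \<open>An exceptional \<open>t\<close> lies on an orbit on which \<open>h\<close> varies, hence on one that meets \<open>S\<close>, and
    each orbit has finitely many exceptional points.\<close>
  have "{t \<in> \<Gamma>. 0 \<le> t \<and> t < a \<and> h t \<noteq> cp}
      \<subseteq> (\<Union>s\<in>S. (\<lambda>n. residue a (w s n)) ` {n. h (w s n) \<noteq> cp})"
  proof
    fix t assume t: "t \<in> {t \<in> \<Gamma>. 0 \<le> t \<and> t < a \<and> h t \<noteq> cp}"
    then have tG: "t \<in> \<Gamma>" by simp
    obtain n where n: "D (w t n) \<noteq> 0"
    proof (rule ccontr)
      assume "\<not> thesis"
      then have z: "h (w t n) = h (w t (n - 1))" for n using that by (auto simp: D_def ww)
      obtain M where M: "M \<ge> 0" "\<And>n. n \<ge> M \<Longrightarrow> h (w t n) = cp" using ends[OF tG] by blast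
      have "h (w t k) = h (w t 0)" if "k \<ge> 0" for k
        using that
      proof (induction k rule: int_ge_induct)
        case (step i)
        then show ?case using z[of "i + 1"] by simp
      qed simp
      from this[OF M(1)] M(2)[of M] show False using t w0 by simp
    qed
    define s where "s = residue a (w t n)"
    have s: "s \<in> S" using n red[OF w[OF tG]] residue_bounds[OF a(2)] hred[OF w[OF tG] b]
      by (simp add: S_def D_def s_def)
    have "residue a (w s (- n)) = t" using t unfolding s_def res_w by (simp add: w0 residue_id)
    moreover have "h (w s (- n)) \<noteq> cp"
    proof -
      have "s \<in> \<Gamma>" using s by (simp add: S_def)
      then have "h (w s (- n)) = h (residue a (w s (- n)))" using hred(1)[OF w tG] by simp
      then show ?thesis using calculation t by simp
    qed
    ultimately show "t \<in> (\<Union>s\<in>S. (\<lambda>n. residue a (w s n)) ` {n. h (w s n) \<noteq> cp})"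
      using s by blast
  qed
  moreover have "finite {n. h (w s n) \<noteq> cp}" if "s \<in> S" for s
  proof -
    have "s \<in> \<Gamma>" using that by (simp add: S_def)
    then obtain M where M: "\<And>n. n \<ge> M \<Longrightarrow> h (w s n) = cp" "\<And>n. n < - M \<Longrightarrow> h (w s n) = cm"
      using ends by blast
    have "{n. h (w s n) \<noteq> cp} \<subseteq> {- M..M}"
    proof
      fix n assume "n \<in> {n. h (w s n) \<noteq> cp}"
      then show "n \<in> {- M..M}" using M(1)[of n] M(2)[of n] cpm by fastforce
    qed
    then show ?thesis by (rule finite_subset) simp
  qed
  then have "finite (\<Union>s\<in>S. (\<lambda>n. residue a (w s n)) ` {n. h (w s n) \<noteq> cp})" using S by simp
  ultimately show ?thesis by (intro exI[of _ cp]) (rule finite_subset)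
qed

section \<open>Locally constant functions on the split line\<close>

text \<open>
  The basic neighbourhoods of a point \<open>x\<close> of the split line: two-sided if \<open>x\<close> is not split,
  and on the one side to which \<open>x\<close> belongs if it is.
\<close>
definition near :: "real \<Rightarrow> split_real \<Rightarrow> split_real \<Rightarrow> bool"
  where "near e x y \<longleftrightarrow> \<bar>q_pt y - q_pt x\<bar> < e \<and> (side x = 1 \<longrightarrow> x \<le> y) \<and> (side x = -1 \<longrightarrow> y \<le> x)"

lemma near_mono: "near d x y \<Longrightarrow> d \<le> e \<Longrightarrow> near e x y"
  by (auto simp: near_def)

lemma split_line_simps [simp]:
  "Pt t \<in> split_line \<Gamma> \<longleftrightarrow> t \<notin> \<Gamma>" "Lft t \<in> split_line \<Gamma> \<longleftrightarrow> t \<in> \<Gamma>" "Rgt t \<in> split_line \<Gamma> \<longleftrightarrow> t \<in> \<Gamma>"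
  by (auto simp: split_line_def)

lemma ex_split_line: "\<exists>x\<in>split_line \<Gamma>. q_pt x = r"
  by (cases "r \<in> \<Gamma>") (auto intro: bexI[of _ "Lft r"] bexI[of _ "Pt r"])

text \<open>
  The rays that generate the order topology contain a \<open>near\<close>-neighbourhood of each of their
  points. Conversely, such a neighbourhood contains an open interval, one of whose end points is
  the twin of \<open>x\<close> if \<open>x\<close> is split.
\<close>

lemma openin_split_line_top:
  "openin (split_line_top \<Gamma>) U \<longleftrightarrow>
    U \<subseteq> split_line \<Gamma> \<and> (\<forall>x\<in>U. \<exists>e>0. \<forall>y\<in>split_line \<Gamma>. near e x y \<longrightarrow> y \<in> U)"
proof -
  let ?X = "split_line \<Gamma>"
  define B where "B = insert ?X ((\<lambda>a. {x \<in> ?X. x < a}) ` ?X \<union> (\<lambda>a. {x \<in> ?X. a < x}) ` ?X)"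
  have top: "split_line_top \<Gamma> = topology_generated_by B"
    by (simp add: split_line_top_def order_topology_on_def B_def)
  have ray: "openin (split_line_top \<Gamma>) {x \<in> ?X. x < c}" "openin (split_line_top \<Gamma>) {x \<in> ?X. c < x}"
    if "c \<in> ?X" for c
    using that by (auto simp: top B_def intro!: topology_generated_by_Basis)
  have fwd: "\<forall>x\<in>U. \<exists>e>0. \<forall>y\<in>?X. near e x y \<longrightarrow> y \<in> U" if "generate_topology_on B U" for U
    using that
  proof (induction rule: generate_topology_on.induct)
    case (Int a b)
    show ?case
    proof
      fix x assume "x \<in> a \<inter> b"
      then obtain d e where "d > 0" "\<forall>y\<in>?X. near d x y \<longrightarrow> y \<in> a" "e > 0" "\<forall>y\<in>?X. near e x y \<longrightarrow> y \<in> b"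
        using Int by blast
      then show "\<exists>e>0. \<forall>y\<in>?X. near e x y \<longrightarrow> y \<in> a \<inter> b"
        using near_mono by (intro exI[of _ "min d e"]) (auto simp: near_def)
    qed
  next
    case (UN K)
    then show ?case by blast
  next
    case (Basis s)
    then consider "s = ?X" | c where "c \<in> ?X" "s = {x \<in> ?X. x < c}" | c where "c \<in> ?X" "s = {x \<in> ?X. c < x}"
      by (auto simp: B_def)
    then show ?case
    proof cases
      case 1
      then show ?thesis by (auto intro: exI[of _ 1])
    next
      case 2
      show ?thesis
      proof
        fix x assume "x \<in> s"
        then have x: "x \<in> ?X" "x < c" using 2 by auto
        show "\<exists>e>0. \<forall>y\<in>?X. near e x y \<longrightarrow> y \<in> s"
        proof (cases "q_pt x < q_pt c")
          case True
          then show ?thesis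
            by (intro exI[of _ "q_pt c - q_pt x"]) (auto simp: near_def 2 less_split_real_def)
        next
          case False
          then have "side x = -1" using x 2(1) by (cases x; cases c) (auto simp: less_split_real_def)
          then show ?thesis using x by (intro exI[of _ 1]) (auto simp: near_def 2)
        qed
      qed
    next
      case 3
      show ?thesis
      proof
        fix x assume "x \<in> s"
        then have x: "x \<in> ?X" "c < x" using 3 by auto
        show "\<exists>e>0. \<forall>y\<in>?X. near e x y \<longrightarrow> y \<in> s"
        proof (cases "q_pt c < q_pt x")
          case True
          then show ?thesis
            by (intro exI[of _ "q_pt x - q_pt c"]) (auto simp: near_def 3 less_split_real_def)
        next
          case False
          then have "side x = 1" using x 3(1) by (cases x; cases c) (auto simp: less_split_real_def)
          then show ?thesis using x by (intro exI[of _ 1]) (auto simp: near_def 3)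
        qed
      qed
    qed
  qed auto
  have bwd: "openin (split_line_top \<Gamma>) U"
    if U: "U \<subseteq> ?X" "\<And>x. x \<in> U \<Longrightarrow> \<exists>e>0. \<forall>y\<in>?X. near e x y \<longrightarrow> y \<in> U" for U
  proof (subst openin_subopen, intro ballI)
    fix x assume x: "x \<in> U"
    then obtain e where e: "e > 0" "\<And>y. y \<in> ?X \<Longrightarrow> near e x y \<Longrightarrow> y \<in> U" using U by blast
    obtain l u where l: "l \<in> ?X" "q_pt l = q_pt x - e / 2" and u: "u \<in> ?X" "q_pt u = q_pt x + e / 2"
      using ex_split_line by metis
    define l' where "l' = (if side x = 1 then Lft (q_pt x) else l)"
    define u' where "u' = (if side x = -1 then Rgt (q_pt x) else u)"
    have X: "l' \<in> ?X" "u' \<in> ?X" using x U(1) l u by (cases x; auto simp: l'_def u'_def)+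
    let ?V = "{y \<in> ?X. l' < y} \<inter> {y \<in> ?X. y < u'}"
    have "openin (split_line_top \<Gamma>) ?V" using ray X by blast
    moreover have "x \<in> ?V"
      using x U(1) l u e(1) by (cases x) (auto simp: l'_def u'_def less_split_real_def)
    moreover have "?V \<subseteq> U"
    proof
      fix y assume y: "y \<in> ?V"
      have "near e x y"
        using y l u e(1) x U(1)
        by (cases x; cases y) (auto simp: near_def l'_def u'_def less_split_real_def less_eq_split_real_def)
      then show "y \<in> U" using e(2) y by blast
    qed
    ultimately show "\<exists>T. openin (split_line_top \<Gamma>) T \<and> x \<in> T \<and> T \<subseteq> U" by blast
  qed
  show ?thesis
  proof
    assume U: "openin (split_line_top \<Gamma>) U"
    have "U \<subseteq> ?X" using openin_subset[OF U] by (simp add: split_line_top_def)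
    moreover have "generate_topology_on B U"
      using U by (simp add: top openin_topology_generated_by_iff)
    ultimately show "U \<subseteq> ?X \<and> (\<forall>x\<in>U. \<exists>e>0. \<forall>y\<in>?X. near e x y \<longrightarrow> y \<in> U)" using fwd by blast
  next
    assume "U \<subseteq> ?X \<and> (\<forall>x\<in>U. \<exists>e>0. \<forall>y\<in>?X. near e x y \<longrightarrow> y \<in> U)"
    then show "openin (split_line_top \<Gamma>) U" by (intro bwd) auto
  qed
qed

abbreviation loc_const :: "real set \<Rightarrow> (split_real \<Rightarrow> int) \<Rightarrow> bool"
  where "loc_const \<Gamma> \<equiv> continuous_map (split_line_top \<Gamma>) (discrete_topology UNIV)"

lemma loc_const_iff:
  "loc_const \<Gamma> F \<longleftrightarrow> (\<forall>x\<in>split_line \<Gamma>. \<exists>e>0. \<forall>y\<in>split_line \<Gamma>. near e x y \<longrightarrow> F y = F x)"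
  (is "_ \<longleftrightarrow> ?R")
proof
  have top: "topspace (split_line_top \<Gamma>) = split_line \<Gamma>" by (simp add: split_line_top_def)
  assume F: "loc_const \<Gamma> F"
  show ?R
  proof
    fix x assume x: "x \<in> split_line \<Gamma>"
    have "openin (split_line_top \<Gamma>) {y \<in> topspace (split_line_top \<Gamma>). F y \<in> {F x}}"
      using F by (rule openin_continuous_map_preimage) simp
    then show "\<exists>e>0. \<forall>y\<in>split_line \<Gamma>. near e x y \<longrightarrow> F y = F x"
      unfolding openin_split_line_top top using x by blast
  qed
next
  have top: "topspace (split_line_top \<Gamma>) = split_line \<Gamma>" by (simp add: split_line_top_def)
  assume R: ?R
  show "loc_const \<Gamma> F"
    unfolding continuous_map_def openin_split_line_top top
  proof (intro conjI allI impI ballI)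
    fix U x assume "x \<in> {x \<in> split_line \<Gamma>. F x \<in> U}"
    then show "\<exists>e>0. \<forall>y\<in>split_line \<Gamma>. near e x y \<longrightarrow> y \<in> {x \<in> split_line \<Gamma>. F x \<in> U}"
      using R by fastforce
  qed auto
qed

lemma loc_constD:
  assumes "loc_const \<Gamma> F" "x \<in> split_line \<Gamma>"
  obtains e where "e > 0" "\<And>y. y \<in> split_line \<Gamma> \<Longrightarrow> near e x y \<Longrightarrow> F y = F x"
  using assms unfolding loc_const_iff by blast

lemma loc_const_affine_act:
  assumes \<Lambda>: "subgroup \<Lambda> pos_real_mult_group" and \<Gamma>: "ZL_module \<Lambda> \<Gamma>"
    and g: "g \<in> carrier (affine_group \<Gamma> \<Lambda>)" and F: "loc_const \<Gamma> F"
  shows "loc_const \<Gamma> (\<lambda>x. F (affine_act g x))"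
  unfolding loc_const_iff
proof
  fix x assume x: "x \<in> split_line \<Gamma>"
  obtain s l where sl: "g = (s, l)" "l \<in> \<Lambda>" using g by (auto simp: affine_group_def)
  have l: "l > 0" using pos_real_subgroupD(1)[OF \<Lambda> sl(2)] .
  obtain e where e: "e > 0"
      "\<And>y. y \<in> split_line \<Gamma> \<Longrightarrow> near e (affine_act g x) y \<Longrightarrow> F y = F (affine_act g x)"
    using loc_constD[OF F affine_act_split_line[OF \<Lambda> \<Gamma> g x]] by blast
  have "near e (affine_act g x) (affine_act g y)" if "near (e / l) x y" for y
  proof -
    have "q_pt (affine_act g z) = l * q_pt z + s" for z by (cases z) (simp_all add: sl)
    then have "q_pt (affine_act g y) - q_pt (affine_act g x) = l * (q_pt y - q_pt x)"
      by (simp add: algebra_simps)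
    moreover have "\<bar>l * (q_pt y - q_pt x)\<bar> < e"
      using that l unfolding near_def abs_mult by (simp add: pos_less_divide_eq mult.commute)
    ultimately show ?thesis
      using that l
      by (cases x; cases y) (auto simp: near_def less_split_real_def less_eq_split_real_def sl)
  qed
  then show "\<exists>e>0. \<forall>y\<in>split_line \<Gamma>. near e x y \<longrightarrow> F (affine_act g y) = F (affine_act g x)"
    using e l affine_act_split_line[OF \<Lambda> \<Gamma> g] by (intro exI[of _ "e / l"]) auto
qed

text \<open>
  Translations are the affine maps for the trivial group of scalars, so what holds for affine
  maps applies to them without reference to \<open>\<Lambda>\<close>.
\<close>

lemma trivial_mult_subgroup: "subgroup {1} pos_real_mult_group"
proof -
  interpret group pos_real_mult_group
  proof (rule groupI)
    show "\<exists>y\<in>carrier pos_real_mult_group. y \<otimes>\<^bsub>pos_real_mult_group\<^esub> x = \<one>\<^bsub>pos_real_mult_group\<^esub>"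
      if "x \<in> carrier pos_real_mult_group" for x
      using that by (intro bexI[of _ "inverse x"]) (simp_all add: pos_real_mult_group_def)
  qed (simp_all add: pos_real_mult_group_def)
  show ?thesis using triv_subgroup by (simp add: pos_real_mult_group_def)
qed

lemma translation_simps [simp]:
  "affine_act (s, 1) (affine_act (t, 1) x) = affine_act (s + t, 1) x"
  "affine_act (0, 1) x = x"
  by (cases x; simp)+

lemma translation_split_line:
  assumes \<Gamma>: "subgroup \<Gamma> real_add_group" and "s \<in> \<Gamma>" "x \<in> split_line \<Gamma>"
  shows "affine_act (s, 1) x \<in> split_line \<Gamma>"
  by (rule affine_act_split_line[OF trivial_mult_subgroup])
    (use assms in \<open>auto simp: ZL_module_def affine_group_def\<close>)

lemma loc_const_translation:
  assumes \<Gamma>: "subgroup \<Gamma> real_add_group" and "s \<in> \<Gamma>" "loc_const \<Gamma> F"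
  shows "loc_const \<Gamma> (\<lambda>x. F (affine_act (s, 1) x))"
  by (rule loc_const_affine_act[OF trivial_mult_subgroup])
    (use assms in \<open>auto simp: ZL_module_def affine_group_def\<close>)

definition jump :: "(split_real \<Rightarrow> int) \<Rightarrow> real \<Rightarrow> int"
  where "jump F t = F (Rgt t) - F (Lft t)"

text \<open>
  Near \<open>r\<close>, on either side of it, a locally constant function has a single value, which it takes
  in particular at both halves of each split point there.
\<close>

lemma loc_const_no_jump_nearby:
  assumes F: "loc_const \<Gamma> F"
  shows "\<exists>e>0. \<forall>t\<in>\<Gamma>. t \<noteq> r \<and> \<bar>t - r\<bar> < e \<longrightarrow> jump F t = 0"
proof (cases "r \<in> \<Gamma>")
  case True
  obtain d where d: "d > 0" "\<And>y. y \<in> split_line \<Gamma> \<Longrightarrow> near d (Lft r) y \<Longrightarrow> F y = F (Lft r)"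
    using loc_constD[OF F, of "Lft r"] True by auto
  obtain e where e: "e > 0" "\<And>y. y \<in> split_line \<Gamma> \<Longrightarrow> near e (Rgt r) y \<Longrightarrow> F y = F (Rgt r)"
    using loc_constD[OF F, of "Rgt r"] True by auto
  have "jump F t = 0" if "t \<in> \<Gamma>" "t \<noteq> r" "\<bar>t - r\<bar> < min d e" for t
  proof (cases "t < r")
    case True
    then show ?thesis using d(2)[of "Lft t"] d(2)[of "Rgt t"] that
      by (simp add: near_def less_eq_split_real_def less_split_real_def jump_def)
  next
    case False
    then show ?thesis using e(2)[of "Lft t"] e(2)[of "Rgt t"] that
      by (simp add: near_def less_eq_split_real_def less_split_real_def jump_def)
  qed
  then show ?thesis using d(1) e(1) by (intro exI[of _ "min d e"]) auto
next
  case False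
  obtain e where e: "e > 0" "\<And>y. y \<in> split_line \<Gamma> \<Longrightarrow> near e (Pt r) y \<Longrightarrow> F y = F (Pt r)"
    using loc_constD[OF F, of "Pt r"] False by auto
  then have "jump F t = 0" if "t \<in> \<Gamma>" "\<bar>t - r\<bar> < e" for t
    using e(2)[of "Lft t"] e(2)[of "Rgt t"] that by (simp add: near_def jump_def)
  then show ?thesis using e(1) by auto
qed

lemma finite_jumps:
  assumes F: "loc_const \<Gamma> F"
  shows "finite {t \<in> \<Gamma>. u \<le> t \<and> t < v \<and> jump F t \<noteq> 0}" (is "finite ?J")
proof (rule ccontr)
  assume "infinite ?J"
  moreover have "compact {u..v}" "?J \<subseteq> {u..v}" by auto
  ultimately obtain r where r: "r islimpt ?J" using Heine_Borel_imp_Bolzano_Weierstrass by blast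
  obtain e where "e > 0" "\<And>t. t \<in> \<Gamma> \<Longrightarrow> t \<noteq> r \<Longrightarrow> \<bar>t - r\<bar> < e \<Longrightarrow> jump F t = 0"
    using loc_const_no_jump_nearby[OF F] by blast
  with r show False unfolding islimpt_approachable dist_real_def by blast
qed

text \<open>
  Without jumps the function factors through the real line as a locally constant function, and
  the real line is connected.
\<close>

lemma no_jumps_imp_const:
  assumes F: "loc_const \<Gamma> F" and j: "\<And>t. t \<in> \<Gamma> \<Longrightarrow> jump F t = 0"
  shows "\<exists>c. \<forall>x\<in>split_line \<Gamma>. F x = c"
proof -
  define p where "p r = (if r \<in> \<Gamma> then Rgt r else Pt r)" for r
  have p: "p r \<in> split_line \<Gamma>" for r by (simp add: p_def)
  have Fp: "F x = F (p (q_pt x))" if "x \<in> split_line \<Gamma>" for x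
    using that j by (cases x) (auto simp: p_def jump_def)
  have "\<exists>e>0. \<forall>t. \<bar>t - r\<bar> < e \<longrightarrow> F (p t) = F (p r)" for r
  proof (cases "r \<in> \<Gamma>")
    case True
    obtain d where d: "d > 0" "\<And>y. y \<in> split_line \<Gamma> \<Longrightarrow> near d (Lft r) y \<Longrightarrow> F y = F (Lft r)"
      using loc_constD[OF F, of "Lft r"] True by auto
    obtain e where e: "e > 0" "\<And>y. y \<in> split_line \<Gamma> \<Longrightarrow> near e (Rgt r) y \<Longrightarrow> F y = F (Rgt r)"
      using loc_constD[OF F, of "Rgt r"] True by auto
    \<comment> \<open>On the left of \<open>r\<close> the value is that at \<open>Lft r\<close>, which is the value at \<open>Rgt r\<close> as \<open>r\<close> is not
      a jump.\<close>
    have "F (p t) = F (p r)" if "\<bar>t - r\<bar> < min d e" for t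
    proof (cases "t < r")
      case l: True
      then have "F (p t) = F (Lft r)"
        using d(2)[OF p, of t] that
        by (auto simp: near_def less_eq_split_real_def less_split_real_def p_def)
      then show ?thesis using j[OF True] True by (simp add: jump_def p_def)
    next
      case l: False
      then have "F (p t) = F (Rgt r)"
        using e(2)[OF p, of t] that True
        by (cases "t = r") (auto simp: near_def less_eq_split_real_def less_split_real_def p_def)
      then show ?thesis using True by (simp add: p_def)
    qed
    moreover have "min d e > 0" using d(1) e(1) by simp
    ultimately show ?thesis by blast
  next
    case False
    obtain e where e: "e > 0" "\<And>y. y \<in> split_line \<Gamma> \<Longrightarrow> near e (Pt r) y \<Longrightarrow> F y = F (Pt r)"
      using loc_constD[OF F, of "Pt r"] False by auto
    have "F (p t) = F (p r)" if "\<bar>t - r\<bar> < e" for t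
      using e(2)[OF p, of t] that False by (auto simp: near_def p_def)
    with e(1) show ?thesis by blast
  qed
  then have "\<forall>\<^sub>F t in at r within UNIV. F (p r) = F (p t)" for r
    unfolding eventually_at dist_real_def by fastforce
  then have "F (p r) = F (p 0)" for r
    by (intro connected_local_const[of UNIV r 0 "\<lambda>t. F (p t)"]) auto
  then have "F x = F (p 0)" if "x \<in> split_line \<Gamma>" for x using Fp[OF that] by simp
  then show ?thesis by blast
qed

text \<open>
  If each translation changes \<open>F\<close> by a constant, then the jump of \<open>F\<close> is the same at all points
  of \<open>\<Gamma>\<close>. It is \<open>0\<close>, as the jumps do not accumulate at \<open>0\<close> but \<open>\<Gamma>\<close> does by density. This gives
  the injectivity of the map on cohomology, and it shows that a cocycle which is constant on
  each translation is constant on each dilation.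
\<close>

lemma loc_const_equivariant_imp_const:
  assumes \<Gamma>: "subgroup \<Gamma> real_add_group" "closure \<Gamma> = UNIV" and F: "loc_const \<Gamma> F"
    and k: "\<And>s. s \<in> \<Gamma> \<Longrightarrow> \<exists>k. \<forall>x\<in>split_line \<Gamma>. F x - F (affine_act (- s, 1) x) = k"
  shows "\<exists>c. \<forall>x\<in>split_line \<Gamma>. F x = c"
proof -
  obtain e where e: "e > 0" "\<And>t. t \<in> \<Gamma> \<Longrightarrow> t \<noteq> 0 \<Longrightarrow> \<bar>t\<bar> < e \<Longrightarrow> jump F t = 0"
    using loc_const_no_jump_nearby[OF F, of 0] by auto
  have "e / 2 \<in> closure \<Gamma>" using \<Gamma>(2) by simp
  then obtain u where u: "u \<in> \<Gamma>" "\<bar>u - e / 2\<bar> < e / 2"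
    using e(1) unfolding closure_approachable dist_real_def by (meson half_gt_zero)
  then have u0: "jump F u = 0" using e(2)[of u] by (auto simp: abs_if split: if_splits)
  have "jump F t = 0" if t: "t \<in> \<Gamma>" for t
  proof -
    have tu: "t - u \<in> \<Gamma>" using real_subgroupD(2)[OF \<Gamma>(1) t real_subgroupD(3)[OF \<Gamma>(1) u(1)]] by simp
    obtain k where k: "\<And>x. x \<in> split_line \<Gamma> \<Longrightarrow> F x - F (affine_act (- (t - u), 1) x) = k"
      using k[OF tu] by blast
    show ?thesis using k[of "Lft t"] k[of "Rgt t"] t u0 by (simp add: jump_def)
  qed
  with F show ?thesis by (rule no_jumps_imp_const)
qed

section \<open>Floor functions on the split line\<close>

text \<open>
  The index of the translate of \<open>[t\<^sub>+, (t + a)\<^sub>-]\<close> by a multiple of \<open>a\<close> that contains the point.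
\<close>
primrec split_floor :: "real \<Rightarrow> real \<Rightarrow> split_real \<Rightarrow> int" where
  "split_floor a t (Lft r) = \<lceil>(r - t) / a\<rceil> - 1"
| "split_floor a t (Pt r) = \<lfloor>(r - t) / a\<rfloor>"
| "split_floor a t (Rgt r) = \<lfloor>(r - t) / a\<rfloor>"

lemma split_floor_eq_iff:
  assumes "0 < a"
  shows "split_floor a t (Lft r) = n \<longleftrightarrow> of_int n * a < r - t \<and> r - t \<le> of_int n * a + a"
    "split_floor a t (Pt r) = n \<longleftrightarrow> of_int n * a \<le> r - t \<and> r - t < of_int n * a + a"
    "split_floor a t (Rgt r) = n \<longleftrightarrow> of_int n * a \<le> r - t \<and> r - t < of_int n * a + a"
proof -
  have "split_floor a t (Lft r) = n \<longleftrightarrow> \<lceil>(r - t) / a\<rceil> = n + 1" by auto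
  then show "split_floor a t (Lft r) = n \<longleftrightarrow> of_int n * a < r - t \<and> r - t \<le> of_int n * a + a"
    using assms by (simp add: ceiling_eq_iff field_simps)
qed (use assms in \<open>simp_all add: floor_eq_iff field_simps\<close>)

lemma loc_const_split_floor:
  assumes \<Gamma>: "subgroup \<Gamma> real_add_group" and a: "a \<in> \<Gamma>" "0 < a" and t: "t \<in> \<Gamma>"
  shows "loc_const \<Gamma> (split_floor a t)"
  unfolding loc_const_iff
proof
  fix x assume x: "x \<in> split_line \<Gamma>"
  define n where "n = split_floor a t x"
  define z where "z = of_int n * a"
  have "t + z \<in> \<Gamma>" unfolding z_def by (intro real_subgroupD(2)[OF \<Gamma>] t real_subgroup_of_int_mult[OF \<Gamma>] a)
  note iff = split_floor_eq_iff[OF a(2), where n = n and t = t, folded z_def]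
  note unf = near_def less_eq_split_real_def less_split_real_def iff
  show "\<exists>e>0. \<forall>y\<in>split_line \<Gamma>. near e x y \<longrightarrow> split_floor a t y = split_floor a t x"
  proof (cases x)
    case (Lft r)
    then have "split_floor a t (Lft r) = n" by (simp only: n_def)
    then have r: "z < r - t" "r - t \<le> z + a" using iff by blast+
    have "split_floor a t y = n" if "near (r - t - z) x y" for y
      using that Lft r by (cases y) (auto simp: unf simp del: split_floor.simps)
    then show ?thesis using r n_def by (intro exI[of _ "r - t - z"]) auto
  next
    case (Pt r)
    then have "r \<notin> \<Gamma>" using x by simp
    then have "r \<noteq> t + z" using \<open>t + z \<in> \<Gamma>\<close> by blast
    moreover have "split_floor a t (Pt r) = n" using Pt by (simp only: n_def)
    then have "z \<le> r - t" "r - t < z + a" using iff by blast+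
    ultimately have r: "z < r - t" "r - t < z + a" by auto
    have "split_floor a t y = n" if "near (min (r - t - z) (z + a - (r - t))) x y" for y
      using that Pt r by (cases y) (auto simp: unf simp del: split_floor.simps)
    then show ?thesis using r n_def by (intro exI[of _ "min (r - t - z) (z + a - (r - t))"]) auto
  next
    case (Rgt r)
    then have "split_floor a t (Rgt r) = n" by (simp only: n_def)
    then have r: "z \<le> r - t" "r - t < z + a" using iff by blast+
    have "split_floor a t y = n" if "near (z + a - (r - t)) x y" for y
      using that Rgt r by (cases y) (auto simp: unf simp del: split_floor.simps)
    then show ?thesis using r n_def by (intro exI[of _ "z + a - (r - t)"]) auto
  qed
qed

lemma split_floor_translation:
  assumes "0 < a"
  shows "split_floor a t (affine_act (a, 1) x) = split_floor a t x + 1"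
proof -
  have "(r + a - t) / a = (r - t) / a + 1" for r using assms by (simp add: field_simps)
  then show ?thesis by (cases x) simp_all
qed

lemma jump_split_floor:
  assumes "0 < a"
  shows "jump (split_floor a t) r = (if residue a r = residue a t then 1 else 0)"
proof -
  let ?u = "(r - t) / a"
  have "residue a r = residue a t \<longleftrightarrow> ?u = of_int \<lfloor>?u\<rfloor>"
  proof
    assume "residue a r = residue a t"
    then obtain m :: int where "r = t + of_int m * a" using residue_eqD by blast
    then show "?u = of_int \<lfloor>?u\<rfloor>" using assms by simp
  next
    assume "?u = of_int \<lfloor>?u\<rfloor>"
    then have "r = t + of_int \<lfloor>?u\<rfloor> * a" using assms by (simp add: field_simps)
    then show "residue a r = residue a t" by (rule residue_cong[OF assms])
  qed
  then show ?thesis by (auto simp: jump_def ceiling_altdef)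
qed

lemma loc_const_diff: "loc_const \<Gamma> F \<Longrightarrow> loc_const \<Gamma> H \<Longrightarrow> loc_const \<Gamma> (\<lambda>x. F x - H x)"
  by (rule continuous_map_discrete_binop[where F = "(-)"])

lemma loc_const_add: "loc_const \<Gamma> F \<Longrightarrow> loc_const \<Gamma> H \<Longrightarrow> loc_const \<Gamma> (\<lambda>x. F x + H x)"
  by (rule continuous_map_discrete_binop[where F = "(+)"])

lemma loc_const_sum:
  assumes "finite S" "\<And>t. t \<in> S \<Longrightarrow> loc_const \<Gamma> (F t)"
  shows "loc_const \<Gamma> (\<lambda>x. \<Sum>t\<in>S. k t * F t x)"
  using assms
proof (induction S)
  case (insert t S)
  then show ?case
    using continuous_map_discrete_binop[of "split_line_top \<Gamma>" "F t" "\<lambda>x. \<Sum>t\<in>S. k t * F t x"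
      "\<lambda>u v. k t * u + v"] by simp
qed simp

text \<open>
  The function \<open>split_floor a t\<close> jumps by \<open>1\<close> exactly on \<open>t + a\<int>\<close>, so a finite combination of
  such functions has the prescribed jumps. It grows by the sum of its coefficients over a period.
\<close>

lemma periodic_jumps_realised:
  assumes \<Gamma>: "subgroup \<Gamma> real_add_group" and a: "a \<in> \<Gamma>" "0 < a"
    and per: "\<And>t. t \<in> \<Gamma> \<Longrightarrow> k (t + a) = k t"
    and fin: "finite {t \<in> \<Gamma>. 0 \<le> t \<and> t < a \<and> k t \<noteq> 0}"
  shows "\<exists>f. loc_const \<Gamma> f \<and> (\<forall>t\<in>\<Gamma>. jump f t = k t) \<and>
    (\<forall>x. f (affine_act (a, 1) x) = f x + (\<Sum>t | t \<in> \<Gamma> \<and> 0 \<le> t \<and> t < a \<and> k t \<noteq> 0. k t))"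
proof -
  define S where "S = {t \<in> \<Gamma>. 0 \<le> t \<and> t < a \<and> k t \<noteq> 0}"
  define f where "f x = (\<Sum>t\<in>S. k t * split_floor a t x)" for x
  have lc: "loc_const \<Gamma> f"
    unfolding f_def
    by (rule loc_const_sum) (use fin in \<open>auto simp: S_def intro!: loc_const_split_floor[OF \<Gamma> a]\<close>)
  have "jump f t = k t" if t: "t \<in> \<Gamma>" for t
  proof -
    have "residue a t \<in> \<Gamma>"
      using real_subgroupD(2)[OF \<Gamma> t real_subgroup_of_int_mult[OF \<Gamma> a(1), of "- \<lfloor>t / a\<rfloor>"]]
      by (simp add: residue_def)
    then have mem: "residue a t \<in> S \<longleftrightarrow> k t \<noteq> 0"
      using residue_bounds[OF a(2)] periodic_residue[where h = k, OF \<Gamma> a(1) per t] by (simp add: S_def)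
    have "jump f t = (\<Sum>u\<in>S. k u * jump (split_floor a u) t)"
      by (simp add: f_def jump_def sum_subtractf right_diff_distrib)
    also have "\<dots> = (\<Sum>u\<in>S. if residue a t = u then k u else 0)"
      by (rule sum.cong) (auto simp: jump_split_floor a S_def residue_id)
    also have "\<dots> = k t"
      using mem fin periodic_residue[where h = k, OF \<Gamma> a(1) per t] by (auto simp: S_def[symmetric])
    finally show ?thesis .
  qed
  moreover have "f (affine_act (a, 1) x) = f x + (\<Sum>t\<in>S. k t)" for x
    by (simp add: f_def split_floor_translation a distrib_left sum.distrib)
  ultimately show ?thesis using lc unfolding S_def by blast
qed

text \<open>
  The function built from the jumps of \<open>F\<close> differs from \<open>F\<close> by a constant, and it grows over a
  period by the sum of the jumps, whereas \<open>F\<close> does not grow.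
\<close>

lemma periodic_imp_sum_jumps_0:
  assumes \<Gamma>: "subgroup \<Gamma> real_add_group" and a: "a \<in> \<Gamma>" "0 < a" and F: "loc_const \<Gamma> F"
    and per: "\<And>x. x \<in> split_line \<Gamma> \<Longrightarrow> F (affine_act (a, 1) x) = F x"
  shows "(\<Sum>t | t \<in> \<Gamma> \<and> 0 \<le> t \<and> t < a \<and> jump F t \<noteq> 0. jump F t) = 0"
proof -
  have "jump F (t + a) = jump F t" if "t \<in> \<Gamma>" for t
    using per[of "Lft t"] per[of "Rgt t"] that by (simp add: jump_def)
  from periodic_jumps_realised[where k = "jump F", OF \<Gamma> a this finite_jumps[OF F]]
  obtain f where f: "loc_const \<Gamma> f" "\<And>t. t \<in> \<Gamma> \<Longrightarrow> jump f t = jump F t"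
    "\<And>x. f (affine_act (a, 1) x) = f x + (\<Sum>t | t \<in> \<Gamma> \<and> 0 \<le> t \<and> t < a \<and> jump F t \<noteq> 0. jump F t)"
    by blast
  have "loc_const \<Gamma> (\<lambda>x. F x - f x)" by (rule loc_const_diff[OF F f(1)])
  moreover have "jump (\<lambda>x. F x - f x) t = 0" if "t \<in> \<Gamma>" for t
    using f(2)[OF that] by (simp add: jump_def)
  ultimately have "\<exists>c. \<forall>x\<in>split_line \<Gamma>. F x - f x = c" by (rule no_jumps_imp_const)
  then obtain c where c: "\<And>x. x \<in> split_line \<Gamma> \<Longrightarrow> F x - f x = c" by blast
  have z: "Rgt 0 \<in> split_line \<Gamma>" using real_subgroupD(1)[OF \<Gamma>] by simp
  show ?thesis
    using c[OF z] c[OF translation_split_line[OF \<Gamma> a(1) z]] per[OF z] f(3)[of "Rgt 0"] by linarith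
qed

section \<open>Cocycles of the translation action\<close>

text \<open>
  The coboundary is removed in two steps. The set \<open>[0\<^sub>+, a\<^sub>-]\<close> is a clopen fundamental domain for
  the translation by \<open>a\<close>, so the restriction to \<open>a\<int>\<close> is the coboundary of a function \<open>f1\<close>, and the
  corrected cocycle \<open>c'\<close> is \<open>a\<close>-periodic. The jumps of \<open>c'\<close> form a cocycle with values in the functions
  on \<open>\<Gamma>\<close>. As \<open>\<Gamma>\<close> acts simply transitively on itself, this cocycle is the coboundary of
  \<open>h t = jump (c' t) t\<close>. Up to a constant \<open>h\<close> has finite support modulo \<open>a\<close>, so it is the jump
  function of some locally constant \<open>f2\<close>, and what remains after removing \<open>f2\<close> has no jumps.
\<close>

lemma translation_cocycle_cohomologous_to_const:
  assumes \<Gamma>: "subgroup \<Gamma> real_add_group" and a: "a \<in> \<Gamma>" "0 < a" and b: "b \<in> \<Gamma>"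
    and indep: "\<And>m n::int. of_int m * a = of_int n * b \<Longrightarrow> n = 0"
    and lc: "\<And>s. s \<in> \<Gamma> \<Longrightarrow> loc_const \<Gamma> (c s)"
    and coc: "\<And>s s' x. s \<in> \<Gamma> \<Longrightarrow> s' \<in> \<Gamma> \<Longrightarrow> x \<in> split_line \<Gamma> \<Longrightarrow>
      c (s + s') x = c s x + c s' (affine_act (- s, 1) x)"
  shows "\<exists>f. loc_const \<Gamma> f \<and>
    (\<forall>s\<in>\<Gamma>. \<exists>k. \<forall>x\<in>split_line \<Gamma>. c s x - (f x - f (affine_act (- s, 1) x)) = k)"
proof -
  note add = real_subgroupD(2)[OF \<Gamma>] and neg = real_subgroupD(3)[OF \<Gamma>]
    and mult = real_subgroup_of_int_mult[OF \<Gamma>]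
  have diff: "x - y \<in> \<Gamma>" if "x \<in> \<Gamma>" "y \<in> \<Gamma>" for x y using add[OF that(1) neg[OF that(2)]] by simp
  note tr = translation_split_line[OF \<Gamma>]
  \<comment> \<open>The choice that vanishes on the fundamental domain: \<open>x\<close> is reached from there by the
    translation by this multiple of \<open>a\<close>.\<close>
  define f1 where "f1 x = c (of_int (split_floor a 0 x) * a) x" for x
  have lc_f1: "loc_const \<Gamma> f1"
    unfolding loc_const_iff
  proof
    fix x assume x: "x \<in> split_line \<Gamma>"
    define s where "s = of_int (split_floor a 0 x) * a"
    have s: "s \<in> \<Gamma>" unfolding s_def by (intro mult a)
    obtain d where d: "d > 0" "\<And>y. y \<in> split_line \<Gamma> \<Longrightarrow> near d x y \<Longrightarrow> split_floor a 0 y = split_floor a 0 x"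
      using loc_constD[OF loc_const_split_floor[OF \<Gamma> a real_subgroupD(1)[OF \<Gamma>]] x] by blast
    obtain e where e: "e > 0" "\<And>y. y \<in> split_line \<Gamma> \<Longrightarrow> near e x y \<Longrightarrow> c s y = c s x"
      using loc_constD[OF lc[OF s] x] by blast
    have "f1 y = f1 x" if "y \<in> split_line \<Gamma>" "near (min d e) x y" for y
      using d(2)[of y] e(2)[of y] that near_mono[OF that(2)] by (simp add: f1_def s_def)
    then show "\<exists>e>0. \<forall>y\<in>split_line \<Gamma>. near e x y \<longrightarrow> f1 y = f1 x"
      using d(1) e(1) by (intro exI[of _ "min d e"]) simp
  qed
  have f1_a: "f1 x - f1 (affine_act (- a, 1) x) = c a x" if x: "x \<in> split_line \<Gamma>" for x
  proof -
    define n where "n = split_floor a 0 (affine_act (- a, 1) x)"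
    have n: "split_floor a 0 x = n + 1"
      using split_floor_translation[OF a(2), of 0 "affine_act (- a, 1) x"] by (simp add: n_def)
    have "c (a + of_int n * a) x = c a x + c (of_int n * a) (affine_act (- a, 1) x)"
      by (intro coc mult a x)
    then show ?thesis using n by (simp add: f1_def n_def[symmetric] algebra_simps)
  qed
  define c' where "c' s x = c s x - (f1 x - f1 (affine_act (- s, 1) x))" for s x
  have lc_c': "loc_const \<Gamma> (c' s)" if s: "s \<in> \<Gamma>" for s
    unfolding c'_def
    by (intro loc_const_diff lc s lc_f1 loc_const_translation[OF \<Gamma>] neg)
  have coc': "c' (s + s') x = c' s x + c' s' (affine_act (- s, 1) x)"
    if "s \<in> \<Gamma>" "s' \<in> \<Gamma>" "x \<in> split_line \<Gamma>" for s s' x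
  proof -
    have "- s' + - s = - (s + s')" by simp
    then have eq: "affine_act (- s', 1) (affine_act (- s, 1) x) = affine_act (- (s + s'), 1) x"
      by (simp only: translation_simps)
    show ?thesis unfolding c'_def coc[OF that] eq by linarith
  qed
  have c'_a: "c' a x = 0" if "x \<in> split_line \<Gamma>" for x using f1_a[OF that] by (simp add: c'_def)
  \<comment> \<open>The translations by \<open>s\<close> and by \<open>a\<close> commute.\<close>
  have per: "c' s (affine_act (- a, 1) x) = c' s x" if s: "s \<in> \<Gamma>" and x: "x \<in> split_line \<Gamma>" for s x
    using coc'[OF a(1) s x] coc'[OF s a(1) x] c'_a[OF x] c'_a[OF tr[OF neg[OF s] x]]
    by (simp add: add.commute)
  have per': "c' s (affine_act (a, 1) x) = c' s x" if s: "s \<in> \<Gamma>" and x: "x \<in> split_line \<Gamma>" for s x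
    using per[OF s tr[OF a(1) x]] by simp
  define h where "h t = jump (c' t) t" for t
  \<comment> \<open>This is the cocycle identity for \<open>t = s + (t - s)\<close>, compared at the two halves of \<open>t\<close>.\<close>
  have jump_h: "jump (c' s) t = h t - h (t - s)" if s: "s \<in> \<Gamma>" and t: "t \<in> \<Gamma>" for s t
    using coc'[OF s diff[OF t s], of "Lft t"] coc'[OF s diff[OF t s], of "Rgt t"] t
    by (simp add: h_def jump_def)
  have h_per: "h (t + a) = h t" if t: "t \<in> \<Gamma>" for t
    using jump_h[OF a(1) add[OF t a(1)]] c'_a add[OF t a(1)] by (simp add: jump_def)
  have jumps_eq: "{t \<in> \<Gamma>. 0 \<le> t \<and> t < a \<and> h t \<noteq> h (t - s)} = {t \<in> \<Gamma>. 0 \<le> t \<and> t < a \<and> jump (c' s) t \<noteq> 0}"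
    if "s \<in> \<Gamma>" for s using jump_h[OF that] by auto
  have "\<exists>k. finite {t \<in> \<Gamma>. 0 \<le> t \<and> t < a \<and> h t \<noteq> k}"
  proof (rule almost_invariant_periodic_eq_const[where h = h, OF \<Gamma> a b indep h_per])
    show "finite {t \<in> \<Gamma>. 0 \<le> t \<and> t < a \<and> h t \<noteq> h (t - s)}" if "s \<in> \<Gamma>" for s
      unfolding jumps_eq[OF that] by (rule finite_jumps[OF lc_c'[OF that]])
    have "(\<Sum>t | t \<in> \<Gamma> \<and> 0 \<le> t \<and> t < a \<and> h t \<noteq> h (t - b). h t - h (t - b))
        = (\<Sum>t | t \<in> \<Gamma> \<and> 0 \<le> t \<and> t < a \<and> jump (c' b) t \<noteq> 0. jump (c' b) t)"
      unfolding jumps_eq[OF b] by (rule sum.cong) (auto simp: jump_h b)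
    also have "\<dots> = 0" by (rule periodic_imp_sum_jumps_0[OF \<Gamma> a lc_c'[OF b] per'[OF b]])
    finally show "(\<Sum>t | t \<in> \<Gamma> \<and> 0 \<le> t \<and> t < a \<and> h t \<noteq> h (t - b). h t - h (t - b)) = 0" .
  qed
  then obtain k where k: "finite {t \<in> \<Gamma>. 0 \<le> t \<and> t < a \<and> h t - k \<noteq> 0}" by auto
  have "h (t + a) - k = h t - k" if "t \<in> \<Gamma>" for t using h_per[OF that] by simp
  from periodic_jumps_realised[where k = "\<lambda>t. h t - k", OF \<Gamma> a this k]
  obtain f2 where f2: "loc_const \<Gamma> f2" "\<And>t. t \<in> \<Gamma> \<Longrightarrow> jump f2 t = h t - k" by blast
  show ?thesis
  proof (intro exI[of _ "\<lambda>x. f1 x + f2 x"] conjI ballI)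
    show "loc_const \<Gamma> (\<lambda>x. f1 x + f2 x)" by (rule loc_const_add[OF lc_f1 f2(1)])
    fix s assume s: "s \<in> \<Gamma>"
    define E where "E x = c' s x - (f2 x - f2 (affine_act (- s, 1) x))" for x
    have "loc_const \<Gamma> E"
      unfolding E_def
      by (intro loc_const_diff lc_c' s f2 loc_const_translation[OF \<Gamma>] neg)
    moreover have "jump E t = 0" if t: "t \<in> \<Gamma>" for t
      using jump_h[OF s t] f2(2)[OF t] f2(2)[OF diff[OF t s]] by (simp add: E_def jump_def)
    ultimately have "\<exists>k. \<forall>x\<in>split_line \<Gamma>. E x = k" by (rule no_jumps_imp_const)
    then show "\<exists>k. \<forall>x\<in>split_line \<Gamma>.
        c s x - (f1 x + f2 x - (f1 (affine_act (- s, 1) x) + f2 (affine_act (- s, 1) x))) = k"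
      by (simp add: E_def c'_def algebra_simps)
  qed
qed

section \<open>A criterion for rigidity\<close>

text \<open>
  Coboundaries of the group vanish, so the classes on the group side are single homomorphisms,
  and \<open>inj\<close> and \<open>surj\<close> are the two halves of bijectivity on representatives. The groupoid
  topology is hidden: as the group is discrete, a cocycle can be tested on each \<open>X \<times> {\<gamma>}\<close>, and the
  unit space is \<open>X\<close>.
\<close>

lemma H1_rigidI:
  fixes act :: "'g \<Rightarrow> 'x \<Rightarrow> 'x"
  assumes G: "group G"
    and inj: "\<And>\<phi> f. \<lbrakk>\<phi> \<in> hom G integer_group; continuous_map X (discrete_topology UNIV) f;
        \<And>\<gamma> x. \<gamma> \<in> carrier G \<Longrightarrow> x \<in> topspace X \<Longrightarrow> \<phi> \<gamma> = f x - f (act (inv\<^bsub>G\<^esub> \<gamma>) x)\<rbrakk>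
      \<Longrightarrow> \<forall>\<gamma>\<in>carrier G. \<phi> \<gamma> = 0"
    and surj: "\<And>\<xi>. \<lbrakk>\<And>\<gamma>. \<gamma> \<in> carrier G \<Longrightarrow> continuous_map X (discrete_topology UNIV) (\<lambda>x. \<xi> (x, \<gamma>));
        \<And>x \<gamma> \<gamma>'. x \<in> topspace X \<Longrightarrow> \<gamma> \<in> carrier G \<Longrightarrow> \<gamma>' \<in> carrier G \<Longrightarrow>
          \<xi> (x, \<gamma> \<otimes>\<^bsub>G\<^esub> \<gamma>') = \<xi> (x, \<gamma>) + \<xi> (act (inv\<^bsub>G\<^esub> \<gamma>) x, \<gamma>')\<rbrakk>
      \<Longrightarrow> \<exists>\<phi> f. \<phi> \<in> hom G integer_group \<and> continuous_map X (discrete_topology UNIV) f \<and>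
        (\<forall>\<gamma>\<in>carrier G. \<forall>x\<in>topspace X. \<xi> (x, \<gamma>) = \<phi> \<gamma> + (f x - f (act (inv\<^bsub>G\<^esub> \<gamma>) x)))"
    and act: "\<And>\<gamma> x. \<gamma> \<in> carrier G \<Longrightarrow> x \<in> topspace X \<Longrightarrow> act \<gamma> x \<in> topspace X"
  shows "H1_rigid X G act"
proof -
  interpret G: group G by fact
  define T where "T = transformation_groupoid X G act"
  define K where "K = group_groupoid G"
  define A where "A = topspace X \<times> carrier G"
  have A: "topspace (arrows T) = A" "topspace (arrows K) = carrier G"
    by (simp_all add: T_def K_def transformation_groupoid_def group_groupoid_def A_def)
  have clT: "gcomp T g h \<in> topspace (arrows T)"
    if "g \<in> topspace (arrows T)" "h \<in> topspace (arrows T)" for g h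
    using that by (auto simp: T_def transformation_groupoid_def)
  interpret ZT: comm_group "Z1 T" by (rule comm_group_Z1[OF clT])
  have BT: "subgroup (B1 T) (Z1 T)" by (rule subgroup_B1[OF clT])
  have nBT: "B1 T \<lhd> Z1 T" by (rule ZT.subgroup_imp_normal[OF BT])
  have BK: "B1 K = {\<one>\<^bsub>Z1 K\<^esub>}" unfolding K_def by (rule B1_group_groupoid[OF G])
  have clK: "gcomp K g h \<in> topspace (arrows K)"
    if "g \<in> topspace (arrows K)" "h \<in> topspace (arrows K)" for g h
    using that by (auto simp: K_def group_groupoid_def)
  interpret ZK: comm_group "Z1 K" by (rule comm_group_Z1[OF clK])
  have cZK: "carrier (Z1 K) = hom G integer_group \<inter> extensional (carrier G)"
    unfolding K_def by (rule carrier_Z1_group_groupoid)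
  have multT: "\<xi> \<otimes>\<^bsub>Z1 T\<^esub> \<eta> = restrict (\<lambda>g. \<xi> g + \<eta> g) A" for \<xi> \<eta> by (simp add: Z1_def A)
  have multK: "\<xi> \<otimes>\<^bsub>Z1 K\<^esub> \<eta> = restrict (\<lambda>g. \<xi> g + \<eta> g) (carrier G)" for \<xi> \<eta> by (simp add: Z1_def A)
  define p where "p \<xi> = restrict (\<xi> \<circ> snd) A" for \<xi> :: "'g \<Rightarrow> int"
  have p_mem: "p \<xi> \<in> carrier (Z1 T)" if "\<xi> \<in> carrier (Z1 K)" for \<xi>
  proof -
    have "continuous_map (arrows T) (discrete_topology UNIV) (\<xi> \<circ> snd)"
      unfolding T_def transformation_groupoid_def
      by (auto intro!: continuous_map_compose[OF continuous_map_snd])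
    then show ?thesis
      unfolding p_def A(1)[symmetric]
      using that clT
      by (intro Z1_restrict_memI)
        (auto simp: cZK hom_def integer_group_def T_def transformation_groupoid_def)
  qed
  have p_hom: "p \<in> hom (Z1 K) (Z1 T)"
  proof (rule homI)
    show "p (\<xi> \<otimes>\<^bsub>Z1 K\<^esub> \<eta>) = p \<xi> \<otimes>\<^bsub>Z1 T\<^esub> p \<eta>" for \<xi> \<eta>
      by (auto simp: p_def multK multT A_def)
  qed (rule p_mem)
  define P where "P \<xi> = B1 T #>\<^bsub>Z1 T\<^esub> p \<xi>" for \<xi>
  have P_hom: "P (\<xi> \<otimes>\<^bsub>Z1 K\<^esub> \<eta>) = P \<xi> \<otimes>\<^bsub>H1 T\<^esub> P \<eta>"
    if "\<xi> \<in> carrier (Z1 K)" "\<eta> \<in> carrier (Z1 K)" for \<xi> \<eta>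
    using normal.rcos_sum[OF nBT p_mem[OF that(1)] p_mem[OF that(2)]] hom_mult[OF p_hom that]
    by (simp add: P_def H1_def FactGroup_def)
  have B1T: "\<exists>f. continuous_map X (discrete_topology UNIV) f \<and>
      (\<forall>\<gamma>\<in>carrier G. \<forall>x\<in>topspace X. \<eta> (x, \<gamma>) = f x - f (act (inv\<^bsub>G\<^esub> \<gamma>) x))"
    if \<eta>: "\<eta> \<in> B1 T" for \<eta>
  proof -
    obtain f where f: "continuous_map (subtopology (arrows T) (units T)) (discrete_topology UNIV) f"
      "\<And>g. g \<in> topspace (arrows T) \<Longrightarrow> \<eta> g = f (rng T g) - f (src T g)"
      using \<eta> by (auto simp only: B1_def)
    have "continuous_map X (subtopology (arrows T) (units T)) (\<lambda>x. (x, \<one>\<^bsub>G\<^esub>))"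
      by (auto simp: T_def transformation_groupoid_def continuous_map_in_subtopology
          intro!: continuous_map_pairedI)
    then have "continuous_map X (discrete_topology UNIV) (\<lambda>x. f (x, \<one>\<^bsub>G\<^esub>))"
      using continuous_map_compose[OF _ f(1)] by (simp add: o_def)
    then show ?thesis using f(2)
      by (intro exI[of _ "\<lambda>x. f (x, \<one>\<^bsub>G\<^esub>)"]) (auto simp: T_def transformation_groupoid_def)
  qed
  have B1T': "\<eta> \<in> B1 T"
    if "\<eta> \<in> carrier (Z1 T)" and f: "continuous_map X (discrete_topology UNIV) f"
      "\<And>\<gamma> x. \<gamma> \<in> carrier G \<Longrightarrow> x \<in> topspace X \<Longrightarrow> \<eta> (x, \<gamma>) = f x - f (act (inv\<^bsub>G\<^esub> \<gamma>) x)" for \<eta> f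
  proof -
    have "continuous_map (subtopology (arrows T) (units T)) (discrete_topology UNIV) (f \<circ> fst)"
      unfolding T_def transformation_groupoid_def
      by (auto intro!: continuous_map_from_subtopology continuous_map_compose[OF continuous_map_fst f(1)])
    moreover have "\<forall>g\<in>topspace (arrows T). \<eta> g = (f \<circ> fst) (rng T g) - (f \<circ> fst) (src T g)"
      using f(2) by (auto simp: T_def transformation_groupoid_def)
    ultimately show ?thesis using that(1) unfolding B1_def by blast
  qed
  have P_inj: "\<xi> = \<eta>" if "\<xi> \<in> carrier (Z1 K)" "\<eta> \<in> carrier (Z1 K)" "P \<xi> = P \<eta>" for \<xi> \<eta>
  proof -
    have "p \<xi> \<in> B1 T #>\<^bsub>Z1 T\<^esub> p \<eta>"
      using ZT.rcos_self[OF p_mem[OF that(1)] BT] that(3) by (simp add: P_def)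
    then obtain \<beta> where \<beta>: "\<beta> \<in> B1 T" "p \<xi> = \<beta> \<otimes>\<^bsub>Z1 T\<^esub> p \<eta>" by (auto simp: r_coset_def)
    obtain f where f: "continuous_map X (discrete_topology UNIV) f"
      "\<And>\<gamma> x. \<gamma> \<in> carrier G \<Longrightarrow> x \<in> topspace X \<Longrightarrow> \<beta> (x, \<gamma>) = f x - f (act (inv\<^bsub>G\<^esub> \<gamma>) x)"
      using B1T[OF \<beta>(1)] by blast
    have "(\<lambda>\<gamma>. \<xi> \<gamma> - \<eta> \<gamma>) \<in> hom G integer_group"
      using that(1,2) by (auto simp: cZK hom_def integer_group_def)
    moreover have "\<xi> \<gamma> - \<eta> \<gamma> = f x - f (act (inv\<^bsub>G\<^esub> \<gamma>) x)"
      if "\<gamma> \<in> carrier G" "x \<in> topspace X" for \<gamma> x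
      using fun_cong[OF \<beta>(2), of "(x, \<gamma>)"] f(2)[OF that] that by (simp add: p_def multT A_def)
    ultimately have "\<forall>\<gamma>\<in>carrier G. \<xi> \<gamma> - \<eta> \<gamma> = 0" using inj[OF _ f(1)] by blast
    then show ?thesis using that(1,2) by (intro extensionalityI[of _ "carrier G"]) (auto simp: cZK)
  qed
  have P_surj: "\<exists>\<phi>\<in>carrier (Z1 K). c = P \<phi>" if c: "c \<in> carrier (H1 T)" for c
  proof -
    obtain \<xi> where \<xi>: "\<xi> \<in> carrier (Z1 T)" "c = B1 T #>\<^bsub>Z1 T\<^esub> \<xi>"
      using c by (auto simp: H1_def FactGroup_def RCOSETS_def)
    have "continuous_map X (discrete_topology UNIV) (\<lambda>x. \<xi> (x, \<gamma>))" if "\<gamma> \<in> carrier G" for \<gamma>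
    proof -
      have "continuous_map X (arrows T) (\<lambda>x. (x, \<gamma>))"
        using that by (auto simp: T_def transformation_groupoid_def intro!: continuous_map_pairedI)
      then have "continuous_map X (discrete_topology UNIV) (\<xi> \<circ> (\<lambda>x. (x, \<gamma>)))"
        by (rule continuous_map_compose) (use \<xi>(1) in \<open>simp add: Z1_def\<close>)
      then show ?thesis by (simp add: o_def)
    qed
    moreover have "\<xi> (x, \<gamma> \<otimes>\<^bsub>G\<^esub> \<gamma>') = \<xi> (x, \<gamma>) + \<xi> (act (inv\<^bsub>G\<^esub> \<gamma>) x, \<gamma>')"
      if "x \<in> topspace X" "\<gamma> \<in> carrier G" "\<gamma>' \<in> carrier G" for x \<gamma> \<gamma>'
    proof -
      let ?g = "(x, \<gamma>)" and ?h = "(act (inv\<^bsub>G\<^esub> \<gamma>) x, \<gamma>')"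
      have mem: "?g \<in> topspace (arrows T)" "?h \<in> topspace (arrows T)" "src T ?g = rng T ?h"
        "gcomp T ?g ?h = (x, \<gamma> \<otimes>\<^bsub>G\<^esub> \<gamma>')"
        using that act by (auto simp: T_def transformation_groupoid_def)
      have "\<xi> (gcomp T g h) = \<xi> g + \<xi> h"
        if "g \<in> topspace (arrows T)" "h \<in> topspace (arrows T)" "src T g = rng T h" for g h
        using \<xi>(1) that by (simp add: Z1_def)
      from this[OF mem(1-3)] show ?thesis by (simp only: mem(4))
    qed
    ultimately obtain \<phi> f where \<phi>: "\<phi> \<in> hom G integer_group"
      and f: "continuous_map X (discrete_topology UNIV) f"
      and eq: "\<And>\<gamma> x. \<gamma> \<in> carrier G \<Longrightarrow> x \<in> topspace X \<Longrightarrow>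
        \<xi> (x, \<gamma>) = \<phi> \<gamma> + (f x - f (act (inv\<^bsub>G\<^esub> \<gamma>) x))"
      using surj[of \<xi>] by blast
    define \<psi> where "\<psi> = restrict \<phi> (carrier G)"
    have \<psi>: "\<psi> \<in> carrier (Z1 K)" using \<phi> by (auto simp: cZK \<psi>_def hom_def)
    define \<beta> where "\<beta> = \<xi> \<otimes>\<^bsub>Z1 T\<^esub> inv\<^bsub>Z1 T\<^esub> p \<psi>"
    have \<beta>c: "\<beta> \<in> carrier (Z1 T)" using \<xi>(1) p_mem[OF \<psi>] by (simp add: \<beta>_def)
    have \<xi>\<beta>: "\<xi> = \<beta> \<otimes>\<^bsub>Z1 T\<^esub> p \<psi>" using \<xi>(1) p_mem[OF \<psi>] by (simp add: \<beta>_def ZT.m_assoc)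
    have "\<beta> \<in> B1 T"
    proof (rule B1T'[OF \<beta>c f])
      fix \<gamma> x assume "\<gamma> \<in> carrier G" "x \<in> topspace X"
      then show "\<beta> (x, \<gamma>) = f x - f (act (inv\<^bsub>G\<^esub> \<gamma>) x)"
        using fun_cong[OF \<xi>\<beta>, of "(x, \<gamma>)"] eq by (simp add: multT A_def p_def \<psi>_def)
    qed
    then have "\<xi> \<in> B1 T #>\<^bsub>Z1 T\<^esub> p \<psi>" using \<xi>\<beta> by (auto simp: r_coset_def)
    then have "c = P \<psi>"
      unfolding \<xi>(2) P_def by (intro ZT.repr_independence[symmetric] p_mem[OF \<psi>] BT)
    then show ?thesis using \<psi> by blast
  qed
  have coset: "B1 K #>\<^bsub>Z1 K\<^esub> \<xi> = {\<xi>}" if "\<xi> \<in> carrier (Z1 K)" for \<xi>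
    using that by (auto simp: BK r_coset_def)
  have H1K: "carrier (H1 K) = (\<lambda>\<xi>. {\<xi>}) ` carrier (Z1 K)"
    unfolding H1_def FactGroup_def RCOSETS_def using coset by auto
  have multH: "{\<xi>} \<otimes>\<^bsub>H1 K\<^esub> {\<eta>} = {\<xi> \<otimes>\<^bsub>Z1 K\<^esub> \<eta>}" for \<xi> \<eta>
    by (auto simp: H1_def FactGroup_def set_mult_def)
  have map: "H1_map T K snd {\<xi>} = P \<xi>" for \<xi>
    by (simp add: H1_map_def P_def p_def A)
  have P_mem: "P \<xi> \<in> carrier (H1 T)" if "\<xi> \<in> carrier (Z1 K)" for \<xi>
    using p_mem[OF that] by (auto simp: P_def H1_def FactGroup_def RCOSETS_def)
  have "H1_map T K snd \<in> iso (H1 K) (H1 T)"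
    unfolding iso_def
  proof (intro CollectI conjI)
    show "H1_map T K snd \<in> hom (H1 K) (H1 T)"
      by (rule homI) (auto simp: H1K map multH P_mem P_hom)
    show "bij_betw (H1_map T K snd) (carrier (H1 K)) (carrier (H1 T))"
      unfolding bij_betw_def
    proof
      show "inj_on (H1_map T K snd) (carrier (H1 K))"
        by (rule inj_onI) (auto simp: H1K map dest: P_inj)
      show "H1_map T K snd ` carrier (H1 K) = carrier (H1 T)"
        using P_surj P_mem by (auto simp: H1K map image_image)
    qed
  qed
  then show ?thesis by (simp add: H1_rigid_def T_def K_def)
qed

section \<open>Rank at least two and rigidity\<close>

text \<open>
  Otherwise \<open>\<Gamma>\<close> would lie in the rational span of a single element.
\<close>

lemma rank_ge_2_imp_independent:
  assumes \<Gamma>: "subgroup \<Gamma> real_add_group" and rank: "ab_rank \<Gamma> \<ge> 2"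
  shows "\<exists>a\<in>\<Gamma>. \<exists>b\<in>\<Gamma>. 0 < a \<and> (\<forall>m n::int. of_int m * a = of_int n * b \<longrightarrow> n = 0)"
proof (rule ccontr)
  assume "\<not> ?thesis"
  then have dep: "\<exists>m n::int. of_int m * a = of_int n * b \<and> n \<noteq> 0"
    if "a \<in> \<Gamma>" "0 < a" "b \<in> \<Gamma>" for a b using that by blast
  obtain a where a: "a \<in> \<Gamma>" "\<Gamma> \<subseteq> rat_real.span {a}"
  proof (cases "\<exists>a\<in>\<Gamma>. 0 < a")
    case True
    then obtain a where a: "a \<in> \<Gamma>" "0 < a" by blast
    have "b \<in> rat_real.span {a}" if b: "b \<in> \<Gamma>" for b
    proof -
      obtain m n :: int where mn: "of_int m * a = of_int n * b" "n \<noteq> 0" using dep[OF a b] by blast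
      have "of_rat (of_int m / of_int n) * a \<in> rat_real.span {a}"
        by (intro rat_real.span_scale rat_real.span_base) simp
      also have "of_rat (of_int m / of_int n) * a = b"
        using mn by (simp add: of_rat_divide field_simps)
      finally show ?thesis .
    qed
    with a show thesis by (intro that[of a]) auto
  next
    case False
    have "b = 0" if b: "b \<in> \<Gamma>" for b
      using False b real_subgroupD(3)[OF \<Gamma> b] by (metis linorder_neqE_linordered_idom neg_0_less_iff_less)
    then have "\<Gamma> \<subseteq> rat_real.span {0}" using rat_real.span_zero by auto
    then show thesis by (rule that[OF real_subgroupD(1)[OF \<Gamma>]])
  qed
  have sp: "rat_real.span {a} = rat_real.span \<Gamma>"
    using a rat_real.span_mono[of "{a}" \<Gamma>] rat_real.span_minimal[OF a(2) rat_real.subspace_span] by auto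
  have "rat_real.dim (rat_real.span \<Gamma>) \<le> card {a}"
    by (rule rat_real.dim_le_card) (use sp in auto)
  then have "ab_rank \<Gamma> \<le> 1"
    using sp by (auto simp: ab_rank_def one_enat_def intro!: exI[of _ "{a}"])
  with rank have "(2::enat) \<le> 1" by (rule order_trans)
  then show False by simp
qed

theorem proposition5p1:
  fixes \<Lambda> \<Gamma> :: "real set" and N :: nat
  assumes "subgroup \<Lambda> pos_real_mult_group"
    and "\<exists>S. finite S \<and> S \<subseteq> \<Lambda> \<and> generate pos_real_mult_group S = \<Lambda>"
    and "pos_real_mult_group\<lparr>carrier := \<Lambda>\<rparr> \<cong> product_group {..<N} (\<lambda>_. integer_group)"
    and "ZL_module \<Lambda> \<Gamma>"
    and "countable \<Gamma>"
    and "closure \<Gamma> = UNIV"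
    and "ab_rank \<Gamma> \<ge> 2"
  shows "H1_rigid (split_line_top \<Gamma>) (affine_group \<Gamma> \<Lambda>) affine_act"
proof -
  note \<Lambda> = assms(1) and mod = assms(4)
  have \<Gamma>: "subgroup \<Gamma> real_add_group" and scale: "\<And>l t. l \<in> \<Lambda> \<Longrightarrow> t \<in> \<Gamma> \<Longrightarrow> l * t \<in> \<Gamma>"
    using mod by (auto simp: ZL_module_def)
  note pos = pos_real_subgroupD[OF \<Lambda>] and zero = real_subgroupD(1)[OF \<Gamma>]
    and add = real_subgroupD(2)[OF \<Gamma>] and neg = real_subgroupD(3)[OF \<Gamma>]
  let ?G = "affine_group \<Gamma> \<Lambda>"
  interpret G: group ?G by (rule group_affine_group[OF \<Lambda> mod])
  have mem: "(s, l) \<in> carrier ?G \<longleftrightarrow> s \<in> \<Gamma> \<and> l \<in> \<Lambda>" for s l by (simp add: affine_group_def)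
  have mult: "(s, l) \<otimes>\<^bsub>?G\<^esub> (s', l') = (s + l * s', l * l')" for s l s' l' by (simp add: affine_group_def)
  have inv: "inv\<^bsub>?G\<^esub> (s, 1) = (- s, 1)" if "s \<in> \<Gamma>" for s
    by (rule G.inv_equality) (use that neg pos(2) in \<open>auto simp: affine_group_def\<close>)
  have act: "affine_act \<gamma> x \<in> split_line \<Gamma>" if "\<gamma> \<in> carrier ?G" "x \<in> split_line \<Gamma>" for \<gamma> x
    by (rule affine_act_split_line[OF \<Lambda> mod that])
  have top: "topspace (split_line_top \<Gamma>) = split_line \<Gamma>" by (simp add: split_line_top_def)
  have z: "Rgt 0 \<in> split_line \<Gamma>" using zero by simp
  show ?thesis
  proof (rule H1_rigidI[OF G.group_axioms], unfold top)
    show "affine_act \<gamma> x \<in> split_line \<Gamma>" if "\<gamma> \<in> carrier ?G" "x \<in> split_line \<Gamma>" for \<gamma> x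
      by (rule act[OF that])
  next
    fix \<phi> f
    assume f: "loc_const \<Gamma> f"
      and eq: "\<And>\<gamma> x. \<gamma> \<in> carrier ?G \<Longrightarrow> x \<in> split_line \<Gamma> \<Longrightarrow>
        \<phi> \<gamma> = f x - f (affine_act (inv\<^bsub>?G\<^esub> \<gamma>) x)"
    have "\<exists>k. \<forall>x\<in>split_line \<Gamma>. f x - f (affine_act (- s, 1) x) = k" if s: "s \<in> \<Gamma>" for s
      using eq[of "(s, 1)"] s pos(2) by (intro exI[of _ "\<phi> (s, 1)"]) (simp add: mem inv)
    then obtain c where c: "\<And>x. x \<in> split_line \<Gamma> \<Longrightarrow> f x = c"
      using loc_const_equivariant_imp_const[OF \<Gamma> assms(6) f] by blast
    show "\<forall>\<gamma>\<in>carrier ?G. \<phi> \<gamma> = 0"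
    proof
      fix \<gamma> assume \<gamma>: "\<gamma> \<in> carrier ?G"
      show "\<phi> \<gamma> = 0" using eq[OF \<gamma> z] c[OF z] c[OF act[OF G.inv_closed[OF \<gamma>] z]] by linarith
    qed
  next
    fix \<xi> :: "split_real \<times> real \<times> real \<Rightarrow> int"
    assume lc: "\<And>\<gamma>. \<gamma> \<in> carrier ?G \<Longrightarrow> loc_const \<Gamma> (\<lambda>x. \<xi> (x, \<gamma>))"
      and coc: "\<And>x \<gamma> \<gamma>'. x \<in> split_line \<Gamma> \<Longrightarrow> \<gamma> \<in> carrier ?G \<Longrightarrow> \<gamma>' \<in> carrier ?G \<Longrightarrow>
          \<xi> (x, \<gamma> \<otimes>\<^bsub>?G\<^esub> \<gamma>') = \<xi> (x, \<gamma>) + \<xi> (affine_act (inv\<^bsub>?G\<^esub> \<gamma>) x, \<gamma>')"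
    obtain a b where ab: "a \<in> \<Gamma>" "0 < a" "b \<in> \<Gamma>" "\<And>m n::int. of_int m * a = of_int n * b \<Longrightarrow> n = 0"
      using rank_ge_2_imp_independent[OF \<Gamma> assms(7)] by blast
    have "\<exists>f. loc_const \<Gamma> f \<and> (\<forall>s\<in>\<Gamma>. \<exists>k. \<forall>x\<in>split_line \<Gamma>.
        \<xi> (x, (s, 1)) - (f x - f (affine_act (- s, 1) x)) = k)"
    proof (rule translation_cocycle_cohomologous_to_const[where c = "\<lambda>s x. \<xi> (x, (s, 1))", OF \<Gamma> ab])
      show "loc_const \<Gamma> (\<lambda>x. \<xi> (x, (s, 1)))" if "s \<in> \<Gamma>" for s
        by (rule lc) (simp add: mem that pos(2))
      show "\<xi> (x, (s + s', 1)) = \<xi> (x, (s, 1)) + \<xi> (affine_act (- s, 1) x, (s', 1))"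
        if "s \<in> \<Gamma>" "s' \<in> \<Gamma>" "x \<in> split_line \<Gamma>" for s s' x
        using coc[of x "(s, 1)" "(s', 1)"] that pos(2) by (simp add: mem mult inv)
    qed
    then obtain f k where f: "loc_const \<Gamma> f" and k: "\<And>s x. s \<in> \<Gamma> \<Longrightarrow> x \<in> split_line \<Gamma> \<Longrightarrow>
        \<xi> (x, (s, 1)) - (f x - f (affine_act (- s, 1) x)) = k s" by metis
    define \<zeta> where "\<zeta> x \<gamma> = \<xi> (x, \<gamma>) - (f x - f (affine_act (inv\<^bsub>?G\<^esub> \<gamma>) x))" for x \<gamma>
    have \<zeta>_lc: "loc_const \<Gamma> (\<lambda>x. \<zeta> x \<gamma>)" if "\<gamma> \<in> carrier ?G" for \<gamma>
      unfolding \<zeta>_def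
      by (intro loc_const_diff lc that f loc_const_affine_act[OF \<Lambda> mod] G.inv_closed)
    have \<zeta>_coc: "\<zeta> x (\<gamma> \<otimes>\<^bsub>?G\<^esub> \<gamma>') = \<zeta> x \<gamma> + \<zeta> (affine_act (inv\<^bsub>?G\<^esub> \<gamma>) x) \<gamma>'"
      if "x \<in> split_line \<Gamma>" "\<gamma> \<in> carrier ?G" "\<gamma>' \<in> carrier ?G" for x \<gamma> \<gamma>'
      unfolding \<zeta>_def coc[OF that] G.inv_mult_group[OF that(2,3)] affine_act_mult by linarith
    have \<zeta>_tr: "\<zeta> x (s, 1) = k s" if "s \<in> \<Gamma>" "x \<in> split_line \<Gamma>" for s x
      using k[OF that] that by (simp add: \<zeta>_def inv)
    have \<zeta>_tr_coc: "\<zeta> x (s, l) = k s + \<zeta> (affine_act (- s, 1) x) (0, l)"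
      if "s \<in> \<Gamma>" "l \<in> \<Lambda>" "x \<in> split_line \<Gamma>" for s l x
      using \<zeta>_coc[of x "(s, 1)" "(0, l)"] that pos(2) zero \<zeta>_tr by (simp add: mem mult inv)
    \<comment> \<open>The relation \<open>(0, l) (t, 1) = (l t, 1) (0, l)\<close> shows that each translation changes
      \<open>\<zeta> x (0, l)\<close> by a constant.\<close>
    have "\<exists>c. \<forall>x\<in>split_line \<Gamma>. \<zeta> x (0, l) = c" if l: "l \<in> \<Lambda>" for l
    proof (rule loc_const_equivariant_imp_const[OF \<Gamma> assms(6)])
      show "loc_const \<Gamma> (\<lambda>x. \<zeta> x (0, l))" by (rule \<zeta>_lc) (simp add: mem zero l)
      fix s assume s: "s \<in> \<Gamma>"
      define t where "t = inverse l * s"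
      have t: "t \<in> \<Gamma>" "l * t = s" using scale[OF pos(4)[OF l] s] pos(1)[OF l] by (simp_all add: t_def)
      have "\<zeta> x (0, l) - \<zeta> (affine_act (- s, 1) x) (0, l) = k s - k t" if x: "x \<in> split_line \<Gamma>" for x
      proof -
        have l': "(0, l) \<in> carrier ?G" by (simp add: mem zero l)
        have "\<zeta> x (s, l) = \<zeta> x (0, l) + k t"
          using \<zeta>_coc[OF x l', of "(t, 1)"] \<zeta>_tr[OF t(1) act[OF G.inv_closed[OF l'] x]] t pos(2)
          by (simp add: mem mult)
        then show ?thesis using \<zeta>_tr_coc[OF s l x] by simp
      qed
      then show "\<exists>d. \<forall>x\<in>split_line \<Gamma>. \<zeta> x (0, l) - \<zeta> (affine_act (- s, 1) x) (0, l) = d" by blast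
    qed
    then obtain c where c: "\<And>l x. l \<in> \<Lambda> \<Longrightarrow> x \<in> split_line \<Gamma> \<Longrightarrow> \<zeta> x (0, l) = c l" by metis
    have const: "\<zeta> x \<gamma> = \<zeta> (Rgt 0) \<gamma>" if g: "\<gamma> \<in> carrier ?G" and x: "x \<in> split_line \<Gamma>" for x \<gamma>
    proof -
      obtain s l where \<gamma>: "\<gamma> = (s, l)" "s \<in> \<Gamma>" "l \<in> \<Lambda>" using g by (cases \<gamma>) (simp add: mem)
      have val: "\<zeta> y \<gamma> = k s + c l" if "y \<in> split_line \<Gamma>" for y
        using \<zeta>_tr_coc[OF \<gamma>(2,3) that] c[OF \<gamma>(3) translation_split_line[OF \<Gamma> neg[OF \<gamma>(2)] that]]
        by (simp add: \<gamma>(1))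
      show ?thesis unfolding val[OF x] val[OF z] ..
    qed
    \<comment> \<open>As \<open>\<zeta>\<close> does not depend on the point, the cocycle identity makes it a homomorphism.\<close>
    have "\<zeta> (Rgt 0) \<in> hom ?G integer_group"
    proof (rule homI)
      fix \<gamma> \<gamma>' assume g: "\<gamma> \<in> carrier ?G" "\<gamma>' \<in> carrier ?G"
      show "\<zeta> (Rgt 0) (\<gamma> \<otimes>\<^bsub>?G\<^esub> \<gamma>') = \<zeta> (Rgt 0) \<gamma> \<otimes>\<^bsub>integer_group\<^esub> \<zeta> (Rgt 0) \<gamma>'"
        using \<zeta>_coc[OF z g] const[OF g(2) act[OF G.inv_closed[OF g(1)] z]] by simp
    qed simp
    moreover have "\<xi> (x, \<gamma>) = \<zeta> (Rgt 0) \<gamma> + (f x - f (affine_act (inv\<^bsub>?G\<^esub> \<gamma>) x))"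
      if "\<gamma> \<in> carrier ?G" "x \<in> split_line \<Gamma>" for x \<gamma>
      using const[OF that] by (simp add: \<zeta>_def)
    ultimately show "\<exists>\<phi> f. \<phi> \<in> hom ?G integer_group \<and> loc_const \<Gamma> f \<and>
        (\<forall>\<gamma>\<in>carrier ?G. \<forall>x\<in>split_line \<Gamma>. \<xi> (x, \<gamma>) = \<phi> \<gamma> + (f x - f (affine_act (inv\<^bsub>?G\<^esub> \<gamma>) x)))"
      using f by blast
  qed
qed

end
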